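(* Let $K$ be a quadratic number field with ring of integers $\mathcal{O}_K$, and let $n\in\mathbb{Z}_{\geq 0}$. For every $R(\mathbf{X})\in\mathbb{Z}[X_1,\ldots,X_n]$, there is a polynomial $$\Phi_{K,n,R}(\mathbf{X},U,V,J)\in\mathbb{Z}[X_1,\ldots,X_n,U,V,J]$$ such that, for every $\mathbf{a}\in\mathcal{O}_K^n$, $$\exists u,v,j\in\mathcal{O}_K\colon\ \Phi_{K,n,R}(\mathbf{a},u,v,j)=0\quad\Longleftrightarrow\quad\mathbf{a}\in\mathbb{Z}^n\text{ and }R(\mathbf{a})\neq 0.$$ Moreover, the polynomial $\Phi_{K,n,R}$ can be constructed effectively from $(K,n,R)$.
   Context: $\mathbf{X}=(X_1,\ldots,X_n)$. Convention: $\mathbb{Z}^0$ and $\mathcal{O}_K^0$ consist of a single empty tuple (and for $n=0$, $R$ is an integer). "Constructed effectively" means that there is an algorithm which, given $(K,n,R)$ (with $K$ given, e.g., by the squarefree integer $D\ne 0,1$ such that $K=\mathbb{Q}(\sqrt{D})$), outputs $\Phi_{K,n,R}$. *)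

theory Defs
  imports
    Complex_Main
    "HOL-Library.Poly_Mapping"
    "HOL-Library.Nat_Bijection"
    "HOL-Computational_Algebra.Polynomial"
    "HOL-Computational_Algebra.Squarefree"
begin

section \<open>Quadratic number fields\<close>

text \<open>
  Number fields are subfields of an arbitrary ambient field of characteristic 0; the ambient
  field may be the number field itself, or for instance the complex numbers.
\<close>

definition subfield_of :: "'a::field_char_0 set \<Rightarrow> bool" where
  "subfield_of K \<longleftrightarrow>
     0 \<in> K \<and> 1 \<in> K \<and>
     (\<forall>x\<in>K. \<forall>y\<in>K. x + y \<in> K \<and> x * y \<in> K) \<and>
     (\<forall>x\<in>K. - x \<in> K \<and> inverse x \<in> K)"

text \<open>
  The dimension function of the library is \<open>0\<close> on infinite-dimensional spaces, so the value
  \<open>2\<close> does say that the degree over the rationals is finite and equal to \<open>2\<close>.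
\<close>

definition quadratic_field :: "'a::field_char_0 set \<Rightarrow> bool" where
  "quadratic_field K \<longleftrightarrow>
     subfield_of K \<and> vector_space.dim (\<lambda>(q::rat) (x::'a). of_rat q * x) K = 2"

definition ring_of_integers :: "'a::field_char_0 set \<Rightarrow> 'a set" where
  "ring_of_integers K = {x \<in> K. algebraic_int x}"

definition rat_adjoin :: "'a::field_char_0 \<Rightarrow> 'a set" where
  "rat_adjoin s = \<Inter> {L. subfield_of L \<and> s \<in> L}"

definition is_rat_adjoin_sqrt :: "'a::field_char_0 set \<Rightarrow> int \<Rightarrow> bool" where
  "is_rat_adjoin_sqrt K D \<longleftrightarrow> (\<exists>s. s ^ 2 = of_int D \<and> K = rat_adjoin s)"


section \<open>Polynomials with integer coefficients in several variables\<close>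

text \<open>
  Finitely supported maps from monomials to coefficients, where a monomial is a finitely
  supported map from variable indices to exponents. The polynomials in \<open>n\<close> variables are
  those in which only the variables with index \<open>0, \<dots>, n - 1\<close> occur.
\<close>

type_synonym int_mpoly = "(nat \<Rightarrow>\<^sub>0 nat) \<Rightarrow>\<^sub>0 int"

definition mpoly_vars :: "int_mpoly \<Rightarrow> nat set" where
  "mpoly_vars p = (\<Union>m \<in> Poly_Mapping.keys p. Poly_Mapping.keys m)"

definition int_mpolys :: "nat \<Rightarrow> int_mpoly set" where
  "int_mpolys n = {p. mpoly_vars p \<subseteq> {..<n}}"

text \<open>
  Evaluation at a tuple, given as a list; it is used only for polynomials in
  \<^term>\<open>int_mpolys (length xs)\<close>.
\<close>

definition mpoly_eval :: "int_mpoly \<Rightarrow> 'a::comm_ring_1 list \<Rightarrow> 'a" where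
  "mpoly_eval p xs =
     (\<Sum>m \<in> Poly_Mapping.keys p.
        of_int (Poly_Mapping.lookup p m) *
        (\<Prod>i \<in> Poly_Mapping.keys m. (xs ! i) ^ Poly_Mapping.lookup m i))"


section \<open>Computability\<close>

text \<open>
  Total recursive (equivalently, Turing computable) functions of \<open>k\<close> natural numbers, with
  minimization restricted to regular functions. Arguments are lists, and only the values on
  lists of length \<open>k\<close> are meaningful: this is what the rule \<open>ext\<close> expresses.
\<close>

inductive total_recursive :: "nat \<Rightarrow> (nat list \<Rightarrow> nat) \<Rightarrow> bool" where
  zero: "total_recursive k (\<lambda>_. 0)"
| succ: "total_recursive 1 (\<lambda>xs. Suc (xs ! 0))"
| proj: "i < k \<Longrightarrow> total_recursive k (\<lambda>xs. xs ! i)"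
| comp: "total_recursive (length fs) g \<Longrightarrow> \<forall>f\<in>set fs. total_recursive k f \<Longrightarrow>
    total_recursive k (\<lambda>xs. g (map (\<lambda>f. f xs) fs))"
| prim_rec: "total_recursive k f \<Longrightarrow> total_recursive (Suc (Suc k)) g \<Longrightarrow>
    total_recursive (Suc k)
      (\<lambda>xs. rec_nat (f (tl xs)) (\<lambda>y r. g (y # r # tl xs)) (hd xs))"
| minimize: "total_recursive (Suc k) f \<Longrightarrow>
    (\<And>xs. length xs = k \<Longrightarrow> \<exists>y. f (y # xs) = 0) \<Longrightarrow>
    total_recursive k (\<lambda>xs. LEAST y. f (y # xs) = 0)"
| ext: "total_recursive k f \<Longrightarrow> (\<And>xs. length xs = k \<Longrightarrow> f xs = g xs) \<Longrightarrow>
    total_recursive k g"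

text \<open>
  A polynomial is presented to an algorithm as a finite list of terms, each of which is a pair
  of a coefficient and a list of exponents (missing exponents are \<open>0\<close>); it is the sum of these
  terms. Such lists are coded by natural numbers in the usual way. A polynomial has several
  codes, since terms may be permuted, split, or padded with zeros.
\<close>

definition term_of_code :: "nat \<Rightarrow> int_mpoly" where
  "term_of_code t =
     (case prod_decode t of (c, e) \<Rightarrow>
        Poly_Mapping.single (Poly_Mapping.nth (list_decode e)) (int_decode c))"

definition mpoly_of_code :: "nat \<Rightarrow> int_mpoly" where
  "mpoly_of_code c = sum_list (map term_of_code (list_decode c))"

end

theory Submission
  imports
    Defs
    "HOL-Analysis.Kronecker_Approximation_Theorem"
    "HOL-Number_Theory.Cong"
begin

text \<open>
  Put \<open>d = D\<close> for real and \<open>d = 3\<close> for imaginary \<open>K = \<rat>(\<surd>D)\<close>. Then all solutions of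
  \<open>x\<^sup>2 - d y\<^sup>2 = 1\<close> in \<open>\<O>\<^sub>K\<close> are rational integers, so making \<open>1 + d y\<^sup>2\<close> a square forces \<open>y\<close>
  into \<open>\<int>\<close>. First, \<open>u = W w\<close> is forced into \<open>\<int>\<close>, where \<open>W\<close> is a multiple of \<open>R(a)\<close> that
  dominates the irrational parts of all \<open>a\<^sub>i\<close>. Tripling in the Pell group yields polynomials
  \<open>g\<^sub>0 = u, g\<^sub>1, \<dots>, g\<^sub>n = P\<close> in \<open>u\<close> which grow fast enough to serve as a mixed radix system.
  Next, \<open>P v\<close> is forced into \<open>\<int>\<close> for \<open>v = 1 + 2 \<Sum> a\<^sub>i g\<^sub>i + P r\<close>; hence \<open>v \<in> \<int>\<close>, and comparing
  irrational parts digit by digit gives \<open>a\<^sub>i \<in> \<int>\<close>. Conversely, the Pell numbers divisible by \<open>P\<close>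
  have quotients in every odd residue class modulo \<open>P\<^sup>2\<close>, so for integral \<open>a\<close> a suitable \<open>r\<close>
  exists, and its residue modulo \<open>P\<close> can be prescribed. That freedom is used to get
  \<open>P dvd (2 r - 1) (3 r - 1)\<close>, a condition which excludes \<open>P = 0\<close>. Finally, the two square
  conditions and the divisibility are merged into one equation with the single unknown \<open>j\<close>,
  the value \<open>(2 r - 1) (3 r - 1) / P + x + d X\<close> for the two square roots \<open>x\<close> and \<open>X\<close>.
\<close>


section \<open>Recursive functions\<close>

named_theorems rec_intros

lemma total_recursive_const [rec_intros]: "total_recursive k (\<lambda>_. c)"
proof (induction c)
  case 0
  show ?case by (rule total_recursive.zero)
next
  case (Suc c)
  have "total_recursive (length [\<lambda>_::nat list. c]) (\<lambda>xs. Suc (xs ! 0))"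
    using total_recursive.succ by simp
  from total_recursive.comp[OF this, of k] Suc show ?case by simp
qed

lemmas total_recursive_proj [rec_intros] = total_recursive.proj

text \<open>Curried variants of \<open>comp\<close>: once instantiated with a concrete
  \<open>f\<close>, their conclusions match ordinary terms, so recursiveness can be shown by
  following the syntax of a definition.\<close>

lemma total_recursive_comp1:
  assumes "total_recursive 1 (\<lambda>xs. f (xs ! 0))" "total_recursive k g"
  shows "total_recursive k (\<lambda>xs. f (g xs))"
  using total_recursive.comp[of "[g]" "\<lambda>xs. f (xs ! 0)" k] assms by simp

lemma total_recursive_comp2:
  assumes "total_recursive 2 (\<lambda>xs. f (xs ! 0) (xs ! 1))"
    and "total_recursive k g" "total_recursive k h"
  shows "total_recursive k (\<lambda>xs. f (g xs) (h xs))"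
  using total_recursive.comp[of "[g, h]" "\<lambda>xs. f (xs ! 0) (xs ! 1)" k] assms
  by (simp add: numeral_2_eq_2)

lemma total_recursive_comp3:
  assumes "total_recursive 3 (\<lambda>xs. f (xs ! 0) (xs ! 1) (xs ! 2))"
    and "total_recursive k g" "total_recursive k h" "total_recursive k l"
  shows "total_recursive k (\<lambda>xs. f (g xs) (h xs) (l xs))"
  using total_recursive.comp[of "[g, h, l]" "\<lambda>xs. f (xs ! 0) (xs ! 1) (xs ! 2)" k] assms
  by (simp add: numeral_3_eq_3)

text \<open>The rule \<open>prim_rec\<close> recurses on the head of the list and keeps the tail as
  parameters. Feeding it \<open>N xs\<close> followed by all of \<open>xs\<close> allows a computed
  recursion bound. In the premise on \<open>G\<close>, the counter and the accumulator occupy the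
  first two places, hence the double \<open>tl\<close>.\<close>

lemma total_recursive_rec_nat [rec_intros]:
  assumes N: "total_recursive k N" and F: "total_recursive k F"
    and G: "total_recursive (Suc (Suc k)) (\<lambda>xs. G (xs ! 0) (xs ! 1) (tl (tl xs)))"
  shows "total_recursive k (\<lambda>xs. rec_nat (F xs) (\<lambda>y r. G y r xs) (N xs))"
proof -
  define h where "h = (\<lambda>xs. rec_nat (F (tl xs)) (\<lambda>y r. G y r (tl xs)) (hd xs))"
  have h: "total_recursive (Suc k) h"
    using total_recursive.prim_rec[OF F G] by (simp add: h_def)
  define fs where "fs = N # map (\<lambda>i xs. xs ! i) [0..<k]"
  have "total_recursive k (\<lambda>xs. h (map (\<lambda>f. f xs) fs))"
    by (rule total_recursive.comp) (use h N in \<open>auto simp: fs_def intro: total_recursive.proj\<close>)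
  then show ?thesis
  proof (rule total_recursive.ext)
    fix xs :: "nat list" assume "length xs = k"
    then have "map (\<lambda>f. f xs) fs = N xs # xs"
      by (auto simp: fs_def intro: nth_equalityI)
    then show "h (map (\<lambda>f. f xs) fs) = rec_nat (F xs) (\<lambda>y r. G y r xs) (N xs)"
      by (simp add: h_def)
  qed
qed

text \<open>Inside a step function the outer arguments are read through the double \<open>tl\<close>
  left by \<open>total_recursive_rec_nat\<close>.\<close>

lemma total_recursive_proj_tl [rec_intros]:
  assumes "i < k"
  shows "total_recursive (Suc (Suc k)) (\<lambda>xs. tl (tl xs) ! i)"
proof (rule total_recursive.ext)
  show "total_recursive (Suc (Suc k)) (\<lambda>xs. xs ! Suc (Suc i))"
    using assms by (intro total_recursive.proj) auto
qed (use assms in \<open>auto simp: nth_tl\<close>)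

lemmas total_recursive_Suc [rec_intros] =
  total_recursive_comp1[of Suc, OF total_recursive.succ]

section \<open>Arithmetic of natural numbers\<close>

lemma total_recursive_add [rec_intros]:
  assumes "total_recursive k f" "total_recursive k g"
  shows "total_recursive k (\<lambda>xs. f xs + g xs)"
proof -
  have eq: "rec_nat m (\<lambda>_. Suc) n = m + n" for m n
    by (induction n) auto
  have "total_recursive 2 (\<lambda>xs. rec_nat (xs ! 0) (\<lambda>_ r. Suc r) (xs ! 1))"
    by (intro rec_intros) auto
  from total_recursive_comp2[OF this assms] show ?thesis
    by (simp only: eq)
qed

lemma total_recursive_mult [rec_intros]:
  assumes "total_recursive k f" "total_recursive k g"
  shows "total_recursive k (\<lambda>xs. f xs * g xs)"
proof -
  have eq: "rec_nat 0 (\<lambda>_ r. r + m) n = m * n" for m n :: nat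
    by (induction n) auto
  have "total_recursive 2 (\<lambda>xs. rec_nat 0 (\<lambda>_ r. r + xs ! 0) (xs ! 1))"
    by (intro rec_intros) auto
  from total_recursive_comp2[OF this assms] show ?thesis
    by (simp only: eq)
qed

lemma total_recursive_diff [rec_intros]:
  assumes "total_recursive k f" "total_recursive k g"
  shows "total_recursive k (\<lambda>xs. f xs - g xs)"
proof -
  \<comment> \<open>The predecessor: the step returns its counter and forgets the
    accumulator.\<close>
  have eq1: "rec_nat 0 (\<lambda>y _. y) n = n - 1" for n :: nat
    by (cases n) auto
  have "total_recursive 1 (\<lambda>xs. rec_nat 0 (\<lambda>y _. y) (xs ! 0))"
    by (intro rec_intros) auto
  then have pred: "total_recursive 1 (\<lambda>xs. xs ! 0 - 1)"
    by (simp add: eq1)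
  have eq: "rec_nat m (\<lambda>_ r. r - 1) n = m - n" for m n :: nat
    by (induction n) auto
  have "total_recursive 2 (\<lambda>xs. rec_nat (xs ! 0) (\<lambda>_ r. r - 1) (xs ! 1))"
    by (intro rec_intros total_recursive_comp1[of "\<lambda>x. x - 1", OF pred]) auto
  from total_recursive_comp2[OF this assms] show ?thesis
    by (simp only: eq)
qed

lemma total_recursive_mod2 [rec_intros]:
  assumes "total_recursive k f"
  shows "total_recursive k (\<lambda>xs. f xs mod 2)"
proof -
  have eq: "rec_nat 0 (\<lambda>_ r. 1 - r) n = n mod 2" for n :: nat
    by (induction n) (auto simp: mod_Suc)
  have "total_recursive 1 (\<lambda>xs. rec_nat 0 (\<lambda>_ r. 1 - r) (xs ! 0))"
    by (intro rec_intros) auto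
  from total_recursive_comp1[OF this assms] show ?thesis
    by (simp only: eq)
qed

lemma total_recursive_div2 [rec_intros]:
  assumes "total_recursive k f"
  shows "total_recursive k (\<lambda>xs. f xs div 2)"
proof -
  \<comment> \<open>The recursion counts the odd numbers below \<open>n\<close>.\<close>
  have eq: "rec_nat 0 (\<lambda>y r. r + y mod 2) n = n div 2" for n :: nat
    by (induction n) (auto, presburger)
  have "total_recursive 1 (\<lambda>xs. rec_nat 0 (\<lambda>y r. r + y mod 2) (xs ! 0))"
    by (intro rec_intros) auto
  from total_recursive_comp1[OF this assms] show ?thesis
    by (simp only: eq)
qed

section \<open>The Cantor pairing function and its inverse\<close>

lemma total_recursive_triangle [rec_intros]:
  assumes "total_recursive k f"
  shows "total_recursive k (\<lambda>xs. triangle (f xs))"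
  unfolding triangle_def using assms by (intro rec_intros)

lemma total_recursive_prod_encode [rec_intros]:
  assumes "total_recursive k f" "total_recursive k g"
  shows "total_recursive k (\<lambda>xs. prod_encode (f xs, g xs))"
  unfolding prod_encode_def prod.case using assms by (intro rec_intros)

lemma prod_decode_0 [simp]: "prod_decode 0 = (0, 0)"
  by (simp add: prod_decode_def prod_decode_aux.simps)

lemma triangle_mono: "m \<le> n \<Longrightarrow> triangle m \<le> triangle n"
  by (induction rule: dec_induct) auto

text \<open>For \<open>z = prod_encode (a, b) = triangle (a + b) + a\<close> the antidiagonal
  \<open>a + b\<close> is the least \<open>y\<close> with \<open>z < triangle (Suc y)\<close>. This
  turns unpairing into a minimization followed by subtractions.\<close>

lemma prod_decode_eq_Least:
  defines "diag \<equiv> \<lambda>z. LEAST y. Suc z - triangle (Suc y) = 0"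
  shows "prod_decode z = (z - triangle (diag z), diag z - (z - triangle (diag z)))"
proof -
  obtain a b where ab: "prod_decode z = (a, b)" by force
  then have z: "z = triangle (a + b) + a"
    using prod_decode_inverse[of z] by (simp add: prod_encode_def)
  have "diag z = a + b"
    unfolding diag_def
  proof (rule Least_equality)
    fix y assume y: "Suc z - triangle (Suc y) = 0"
    show "a + b \<le> y"
    proof (rule ccontr)
      assume "\<not> a + b \<le> y"
      then have "triangle (Suc y) \<le> triangle (a + b)"
        by (intro triangle_mono) auto
      with y z show False by auto
    qed
  qed (use z in auto)
  then show ?thesis using ab z by (simp del: triangle_Suc)
qed

lemma total_recursive_diagonal:
  "total_recursive 1 (\<lambda>xs. LEAST y. Suc (xs ! 0) - triangle (Suc y) = 0)"
proof -
  define f where "f = (\<lambda>xs :: nat list. Suc (xs ! 1) - triangle (Suc (xs ! 0)))"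
  have "total_recursive 1 (\<lambda>xs. LEAST y. f (y # xs) = 0)"
  proof (rule total_recursive.minimize)
    show "total_recursive (Suc 1) f"
      unfolding f_def by (intro rec_intros) auto
    fix xs :: "nat list"
    \<comment> \<open>The search therefore ends at \<open>xs ! 0\<close> at the latest, which makes
      the minimization regular.\<close>
    have "n \<le> triangle n" for n
      by (induction n) auto
    then show "\<exists>y. f (y # xs) = 0"
      by (intro exI[of _ "xs ! 0"]) (auto simp: f_def simp del: triangle_Suc)
  qed
  then show ?thesis by (simp add: f_def)
qed

lemma total_recursive_prod_decode [rec_intros]:
  assumes "total_recursive k f"
  shows "total_recursive k (\<lambda>xs. fst (prod_decode (f xs)))"
    and "total_recursive k (\<lambda>xs. snd (prod_decode (f xs)))"
  unfolding prod_decode_eq_Least fst_conv snd_conv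
  by (intro rec_intros assms
    total_recursive_comp1[of "\<lambda>z. LEAST y. Suc z - triangle (Suc y) = 0", OF total_recursive_diagonal])+


section \<open>Arithmetic of polynomials on codes\<close>

text \<open>A nonempty list is coded by the successor of a pair, the empty list by 0. Truncated
  subtraction and \<open>prod_decode 0 = (0, 0)\<close> make 0 its own tail.\<close>

definition tl_code :: "nat \<Rightarrow> nat" where
  "tl_code l = snd (prod_decode (l - 1))"

definition nth_code :: "nat \<Rightarrow> nat \<Rightarrow> nat" where
  "nth_code l i = fst (prod_decode (rec_nat l (\<lambda>_. tl_code) i - 1))"

definition cons_code :: "nat \<Rightarrow> nat \<Rightarrow> nat" where
  "cons_code x l = Suc (prod_encode (x, l))"

lemma total_recursive_cons_code [rec_intros]:
  assumes "total_recursive k f" "total_recursive k g"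
  shows "total_recursive k (\<lambda>xs. cons_code (f xs) (g xs))"
  unfolding cons_code_def by (intro rec_intros assms)

lemma total_recursive_nth_code [rec_intros]:
  assumes "total_recursive k f" "total_recursive k g"
  shows "total_recursive k (\<lambda>xs. nth_code (f xs) (g xs))"
  unfolding nth_code_def tl_code_def by (intro rec_intros assms) auto

lemma list_decode_cons_code [simp]: "list_decode (cons_code x l) = x # list_decode l"
  by (simp add: cons_code_def)

lemma list_decode_tl_code: "list_decode (tl_code l) = tl (list_decode l)"
proof (cases l)
  case 0
  then show ?thesis by (simp add: tl_code_def)
next
  case (Suc m)
  then show ?thesis by (simp add: tl_code_def split: prod.split)
qed

text \<open>Iterated tails drop a prefix; past the end the code is 0, and its head reads as 0. This
  default stands for the zero term or the exponent 0, so overrunning a list does no harm.\<close>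

lemma nth_code: "nth_code l i = nth_default 0 (list_decode l) i"
proof -
  define m where "m = rec_nat l (\<lambda>_. tl_code) i"
  have m: "list_decode m = drop i (list_decode l)"
    unfolding m_def by (induction i) (simp_all add: list_decode_tl_code tl_drop drop_Suc)
  show ?thesis
  proof (cases m)
    case 0
    with m have "length (list_decode l) \<le> i" by simp
    then show ?thesis
      using 0 by (simp add: nth_code_def nth_default_beyond flip: m_def)
  next
    case (Suc m')
    with m have *: "drop i (list_decode l) = fst (prod_decode m') # list_decode (snd (prod_decode m'))"
      by (simp split: prod.splits)
    then have "i < length (list_decode l)"
      by (metis drop_all list.distinct(1) not_le)
    with * show ?thesis
      using Suc by (simp add: nth_code_def nth_default_nth flip: m_def)
        (metis Cons_nth_drop_Suc list.inject)
  qed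
qed

text \<open>Tails have smaller codes. Hence the code of a list can itself serve as a loop bound, and
  no length has to be computed.\<close>

lemma length_list_decode_le: "length (list_decode n) \<le> n"
proof (induction n rule: list_decode.induct)
  case (2 n)
  obtain x y where xy: "prod_decode n = (x, y)" by force
  then have "y \<le> n"
    using le_prod_encode_2[of y x] by (metis prod_decode_inverse)
  with 2 xy show ?case by simp
qed simp

lemma sum_list_map_eq_sum_nth_default:
  fixes f :: "nat \<Rightarrow> 'b::comm_monoid_add"
  assumes "f 0 = 0" "length xs \<le> N"
  shows "sum_list (map f xs) = (\<Sum>i<N. f (nth_default 0 xs i))"
proof -
  have "sum_list (map f xs) = (\<Sum>i<length xs. f (nth_default 0 xs i))"
    by (simp add: sum_list_sum_nth nth_default_nth atLeast0LessThan)
  also have "\<dots> = (\<Sum>i<N. f (nth_default 0 xs i))"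
    using assms by (intro sum.mono_neutral_left) (auto simp: nth_default_beyond)
  finally show ?thesis .
qed

section \<open>Sums and products of coded polynomials\<close>

lemma term_of_code_0 [simp]: "term_of_code 0 = 0"
  by (simp add: term_of_code_def int_decode_def sum_decode_def)

lemma mpoly_of_code_0 [simp]: "mpoly_of_code 0 = 0"
  by (simp add: mpoly_of_code_def)

lemma mpoly_of_code_eq_sum:
  "mpoly_of_code c = (\<Sum>i<c. term_of_code (nth_code c i))"
  unfolding mpoly_of_code_def nth_code
  by (rule sum_list_map_eq_sum_nth_default) (simp_all add: length_list_decode_le)

lemma mpoly_of_code_cons_code [simp]:
  "mpoly_of_code (cons_code t c) = term_of_code t + mpoly_of_code c"
  by (simp add: mpoly_of_code_def)

text \<open>The entries of \<open>b\<close> are prepended in reverse order, together with zero terms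
  read past its end; neither affects the sum.\<close>

definition add_code :: "nat \<Rightarrow> nat \<Rightarrow> nat" where
  "add_code b c = rec_nat c (\<lambda>i. cons_code (nth_code b i)) b"

lemma total_recursive_add_code [rec_intros]:
  assumes "total_recursive k f" "total_recursive k g"
  shows "total_recursive k (\<lambda>xs. add_code (f xs) (g xs))"
proof -
  have "total_recursive 2 (\<lambda>xs. add_code (xs ! 0) (xs ! 1))"
    unfolding add_code_def by (intro rec_intros) auto
  from total_recursive_comp2[OF this assms] show ?thesis .
qed

lemma mpoly_of_code_add [simp]:
  "mpoly_of_code (add_code b c) = mpoly_of_code b + mpoly_of_code c"
proof -
  have "mpoly_of_code (rec_nat c (\<lambda>i. cons_code (nth_code b i)) N) =
      (\<Sum>i<N. term_of_code (nth_code b i)) + mpoly_of_code c" for N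
    by (induction N) (simp_all add: algebra_simps)
  then show ?thesis by (simp add: add_code_def flip: mpoly_of_code_eq_sum)
qed

text \<open>Since \<open>int_decode\<close> maps \<open>2 * z\<close> to \<open>z\<close> and
  \<open>2 * z - 1\<close> to \<open>- z\<close>, the absolute value is \<open>Suc a div 2\<close>
  and the parity of \<open>a\<close> is the sign. If a factor is 0, truncated subtraction still
  yields 0.\<close>

definition int_mult_code :: "nat \<Rightarrow> nat \<Rightarrow> nat" where
  "int_mult_code a b = 2 * ((Suc a div 2) * (Suc b div 2)) - (a + b) mod 2"

lemma int_decode_eq: "int_decode c = (if even c then int (c div 2) else - int (Suc c div 2))"
  by (auto simp: int_decode_def sum_decode_def)

lemma int_decode_mult_code: "int_decode (int_mult_code a b) = int_decode a * int_decode b"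
proof -
  define x y where "x = Suc a div 2" and "y = Suc b div 2"
  have a: "a = (if even a then 2 * x else 2 * x - 1)" and a': "odd a \<Longrightarrow> x > 0"
    by (auto simp: x_def elim!: evenE oddE)
  have b: "b = (if even b then 2 * y else 2 * y - 1)" and b': "odd b \<Longrightarrow> y > 0"
    by (auto simp: y_def elim!: evenE oddE)
  have da: "int_decode a = (if even a then int x else - int x)"
    by (auto simp: int_decode_eq x_def)
  have db: "int_decode b = (if even b then int y else - int y)"
    by (auto simp: int_decode_eq y_def)
  have "int_mult_code a b = (if even a \<longleftrightarrow> even b then 2 * (x * y) else 2 * (x * y) - 1)"
    by (auto simp: int_mult_code_def x_def[symmetric] y_def[symmetric] mod2_eq_if)
  moreover have "int_decode (2 * z) = int z" for z
    by (simp add: int_decode_eq)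
  moreover have "int_decode (2 * z - 1) = - int z" for z
    by (cases z) (auto simp: int_decode_eq)
  ultimately show ?thesis
    by (simp add: da db)
qed

text \<open>Consing builds a list from its end, so the indices run downwards from
  \<open>e + e' - 1\<close>. By \<open>length_list_decode_le\<close> this range covers both exponent
  lists.\<close>

definition monom_mult_code :: "nat \<Rightarrow> nat \<Rightarrow> nat" where
  "monom_mult_code e e' = rec_nat 0
     (\<lambda>j. cons_code (nth_code e (e + e' - Suc j) + nth_code e' (e + e' - Suc j))) (e + e')"

lemma nth_monom_mult_code:
  "Poly_Mapping.nth (list_decode (monom_mult_code e e')) =
     (Poly_Mapping.nth (list_decode e) + Poly_Mapping.nth (list_decode e') :: nat \<Rightarrow>\<^sub>0 nat)"
proof -
  define N where "N = e + e'"
  define f where "f = (\<lambda>i. nth_code e i + nth_code e' i)"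
  \<comment> \<open>Loop invariant: after \<open>k\<close> rounds the last \<open>k\<close> entries
    are in place.\<close>
  have "list_decode (rec_nat 0 (\<lambda>j. cons_code (f (N - Suc j))) k) = map f [N - k..<N]" if "k \<le> N" for k
    using that
  proof (induction k)
    case (Suc k)
    then have "[N - Suc k..<N] = (N - Suc k) # [N - k..<N]"
      by (subst upt_rec) (auto simp: Suc_diff_Suc)
    with Suc show ?case by simp
  qed simp
  from this[of N] have *: "list_decode (monom_mult_code e e') = map f [0..<N]"
    by (simp add: monom_mult_code_def N_def f_def)
  show ?thesis
  proof (rule poly_mapping_eqI)
    fix i
    have "length (list_decode e) \<le> N" "length (list_decode e') \<le> N"
      using length_list_decode_le[of e] length_list_decode_le[of e'] by (auto simp: N_def)
    then show "Poly_Mapping.lookup (Poly_Mapping.nth (list_decode (monom_mult_code e e'))) i =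
        Poly_Mapping.lookup (Poly_Mapping.nth (list_decode e) + Poly_Mapping.nth (list_decode e')) i"
      by (cases "i < N") (auto simp: lookup_add * nth_default_def f_def nth_code)
  qed
qed

definition term_mult_code :: "nat \<Rightarrow> nat \<Rightarrow> nat" where
  "term_mult_code t t' = prod_encode
     (int_mult_code (fst (prod_decode t)) (fst (prod_decode t')),
      monom_mult_code (snd (prod_decode t)) (snd (prod_decode t')))"

lemma term_of_code_mult: "term_of_code (term_mult_code t t') = term_of_code t * term_of_code t'"
  by (simp add: term_of_code_def term_mult_code_def nth_monom_mult_code int_decode_mult_code
      mult_single split: prod.split)

definition scale_code :: "nat \<Rightarrow> nat \<Rightarrow> nat" where
  "scale_code t c = rec_nat 0 (\<lambda>j. cons_code (term_mult_code t (nth_code c j))) c"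

definition mult_code :: "nat \<Rightarrow> nat \<Rightarrow> nat" where
  "mult_code b c = rec_nat 0 (\<lambda>i. add_code (scale_code (nth_code b i) c)) b"

lemma total_recursive_mult_code [rec_intros]:
  assumes "total_recursive k f" "total_recursive k g"
  shows "total_recursive k (\<lambda>xs. mult_code (f xs) (g xs))"
proof -
  have "total_recursive 2 (\<lambda>xs. monom_mult_code (xs ! 0) (xs ! 1))"
    unfolding monom_mult_code_def by (intro rec_intros) auto
  note monom = total_recursive_comp2[of monom_mult_code, OF this]
  have "total_recursive 2 (\<lambda>xs. term_mult_code (xs ! 0) (xs ! 1))"
    unfolding term_mult_code_def int_mult_code_def by (intro rec_intros monom) auto
  note trm = total_recursive_comp2[of term_mult_code, OF this]
  have "total_recursive 2 (\<lambda>xs. scale_code (xs ! 0) (xs ! 1))"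
    unfolding scale_code_def by (intro rec_intros trm) auto
  note scale = total_recursive_comp2[of scale_code, OF this]
  have "total_recursive 2 (\<lambda>xs. mult_code (xs ! 0) (xs ! 1))"
    unfolding mult_code_def by (intro rec_intros scale) auto
  from total_recursive_comp2[OF this assms] show ?thesis .
qed

lemma mpoly_of_code_scale: "mpoly_of_code (scale_code t c) = term_of_code t * mpoly_of_code c"
proof -
  have "mpoly_of_code (rec_nat 0 (\<lambda>j. cons_code (term_mult_code t (nth_code c j))) N) =
      term_of_code t * (\<Sum>j<N. term_of_code (nth_code c j))" for N
    by (induction N) (simp_all add: term_of_code_mult algebra_simps)
  then show ?thesis
    by (simp add: scale_code_def flip: mpoly_of_code_eq_sum)
qed

lemma mpoly_of_code_mult [simp]:
  "mpoly_of_code (mult_code b c) = mpoly_of_code b * mpoly_of_code c"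
proof -
  have "mpoly_of_code (rec_nat 0 (\<lambda>i. add_code (scale_code (nth_code b i) c)) N) =
      (\<Sum>i<N. term_of_code (nth_code b i)) * mpoly_of_code c" for N
    by (induction N) (simp_all add: mpoly_of_code_scale algebra_simps)
  then show ?thesis by (simp add: mult_code_def flip: mpoly_of_code_eq_sum)
qed

text \<open>The argument is the \<open>int_decode\<close> code of the constant:
  \<open>const_code 2\<close> is the polynomial 1 and \<open>const_code 1\<close> is
  \<open>- 1\<close>. The exponent list is empty.\<close>

definition const_code :: "nat \<Rightarrow> nat" where
  "const_code a = cons_code (prod_encode (a, 0)) 0"

lemma total_recursive_const_code [rec_intros]:
  "total_recursive k f \<Longrightarrow> total_recursive k (\<lambda>xs. const_code (f xs))"
  unfolding const_code_def by (intro rec_intros)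

lemma mpoly_of_code_const [simp]: "mpoly_of_code (const_code a) = of_int (int_decode a)"
  by (simp add: const_code_def term_of_code_def flip: single_of_int)

definition mvar :: "nat \<Rightarrow> int_mpoly" where
  "mvar i = Poly_Mapping.single (Poly_Mapping.single i 1) 1"

text \<open>The coefficient code 2 means 1; the exponent list consists of \<open>i\<close> zeros and
  a final 1.\<close>

definition var_code :: "nat \<Rightarrow> nat" where
  "var_code i =
     cons_code (prod_encode (2, rec_nat (cons_code 1 0) (\<lambda>_. cons_code 0) i)) 0"

lemma total_recursive_var_code [rec_intros]:
  "total_recursive k f \<Longrightarrow> total_recursive k (\<lambda>xs. var_code (f xs))"
  unfolding var_code_def by (intro rec_intros) auto

lemma mpoly_of_code_var [simp]: "mpoly_of_code (var_code i) = mvar i"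
proof -
  have *: "list_decode (rec_nat (cons_code 1 0) (\<lambda>_. cons_code 0) i) = replicate i 0 @ [1]"
    by (induction i) auto
  have "Poly_Mapping.nth (replicate i 0 @ [1]) = (Poly_Mapping.single i 1 :: nat \<Rightarrow>\<^sub>0 nat)"
    by (rule poly_mapping_eqI)
      (auto simp: nth_default_def nth_append lookup_single when_def)
  with * show ?thesis
    by (simp add: var_code_def term_of_code_def mvar_def int_decode_eq)
qed


section \<open>Quadratic fields\<close>

text \<open>As \<open>b\<close> is coprime to \<open>a\<close>, all of \<open>b^2\<close> has to
  come from \<open>D\<close>. For squarefree \<open>D\<close> this makes \<open>b\<close> a unit;
  with \<open>D = 1\<close> it shows that a rational square root of an integer is an
  integer.\<close>

lemma int_square_dvd_imp_dvd:
  fixes a b D m :: int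
  assumes "coprime a b" "a\<^sup>2 * D = m * b\<^sup>2"
  shows "b\<^sup>2 dvd D"
proof -
  have "b\<^sup>2 dvd a\<^sup>2 * D" using assms(2) by simp
  moreover have "coprime (b\<^sup>2) (a\<^sup>2)"
    using assms(1) by (simp add: coprime_commute)
  ultimately show ?thesis
    by (simp add: coprime_dvd_mult_right_iff)
qed

text \<open>In lowest terms \<open>a / b\<close>, every power of \<open>b\<close> divides the fixed
  number \<open>M\<close>, which leaves only \<open>b = 1\<close>.\<close>

lemma Rats_bounded_denominator_imp_Ints:
  fixes x :: "'a::field_char_0"
  assumes "x \<in> \<rat>" and M: "M \<noteq> (0::int)" "\<And>k. of_int M * x ^ k \<in> \<int>"
  shows "x \<in> \<int>"
proof -
  obtain a b :: int where ab: "b > 0" "coprime a b" "x = of_int a / of_int b"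
    using assms(1) by (auto elim: Rats_cases')
  have dvd: "b ^ k dvd M" for k
  proof -
    obtain m where "of_int M * x ^ k = of_int m"
      using M(2)[of k] by (auto elim: Ints_cases)
    then have "(of_int (M * a ^ k) :: 'a) = of_int (m * b ^ k)"
      using ab by (simp add: field_simps)
    then have "M * a ^ k = m * b ^ k"
      by (simp only: of_int_eq_iff)
    then have "b ^ k dvd M * a ^ k" by simp
    moreover have "coprime (b ^ k) (a ^ k)"
      using ab(2) by (simp add: coprime_commute)
    ultimately show ?thesis
      by (simp add: coprime_dvd_mult_left_iff)
  qed
  have "b = 1"
  proof (rule ccontr)
    assume "b \<noteq> 1"
    then have "b \<ge> 2" using ab by simp
    obtain k where k: "nat \<bar>M\<bar> < 2 ^ k"
      using less_exp by blast
    have "(2::int) ^ k \<le> b ^ k"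
      using \<open>b \<ge> 2\<close> by (intro power_mono) auto
    also have "\<dots> \<le> \<bar>M\<bar>"
      using dvd[of k] M(1) by (simp add: dvd_imp_le_int zdvd_imp_le)
    finally show False
      using k by (metis int_nat_eq not_le of_nat_less_iff of_nat_numeral of_nat_power abs_ge_zero)
  qed
  then show ?thesis using ab by simp
qed

lemma subfield_of_of_rat:
  fixes L :: "'a::field_char_0 set"
  assumes L: "subfield_of L"
  shows "of_rat r \<in> L"
proof -
  have L0: "0 \<in> L" and L1: "1 \<in> L" and Ladd: "\<And>x y. x \<in> L \<Longrightarrow> y \<in> L \<Longrightarrow> x + y \<in> L"
    and Lmult: "\<And>x y. x \<in> L \<Longrightarrow> y \<in> L \<Longrightarrow> x * y \<in> L"
    and Lminus: "\<And>x. x \<in> L \<Longrightarrow> - x \<in> L" and Linv: "\<And>x. x \<in> L \<Longrightarrow> inverse x \<in> L"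
    using L by (simp_all add: subfield_of_def)
  have L_nat: "of_nat n \<in> L" for n
  proof (induction n)
    case (Suc n)
    then show ?case unfolding of_nat_Suc by (intro Ladd L1)
  qed (simp add: L0)
  have L_int: "of_int i \<in> L" for i
  proof (cases "i \<ge> 0")
    case True
    then show ?thesis using L_nat[of "nat i"] by simp
  next
    case False
    then have "- of_nat (nat (- i)) = (of_int i :: 'a)" by simp
    then show ?thesis using Lminus[OF L_nat[of "nat (- i)"]] by metis
  qed
  obtain a b where "r = of_int a / of_int b"
    by (metis quotient_of_div surj_pair)
  then have "of_rat r = of_int a * inverse (of_int b :: 'a)"
    by (simp add: of_rat_mult of_rat_inverse divide_inverse)
  then show ?thesis using Lmult[OF L_int Linv[OF L_int]] by metis
qed

text \<open>The normal form of a quadratic field; \<open>quadratic_field_obtains\<close> shows that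
  every quadratic field has it.\<close>

locale quadratic =
  fixes s :: "'a::field_char_0" and D :: int
  assumes s2: "s\<^sup>2 = of_int D" and sqfree: "squarefree D" and D_neq_1: "D \<noteq> 1"
begin

lemma s_mult_s: "s * s = of_int D"
  using s2 by (simp add: power2_eq_square)

lemma D_neq_0: "D \<noteq> 0"
  using sqfree by auto

text \<open>For \<open>s = a / b\<close> in lowest terms \<open>b\<close> is 1, so \<open>D\<close>
  is the square \<open>a^2\<close>, which is squarefree only if it is 1.\<close>

lemma s_notin_Rats: "s \<notin> \<rat>"
proof
  assume "s \<in> \<rat>"
  then obtain a b :: int where ab: "b > 0" "coprime a b" "s = of_int a / of_int b"
    by (auto elim: Rats_cases')
  have "of_int D = (of_int a / of_int b :: 'a)\<^sup>2"
    using s2 ab(3) by simp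
  then have "(of_int (a\<^sup>2) :: 'a) = of_int (D * b\<^sup>2)"
    using ab(1) by (simp add: power_divide field_simps)
  then have eq: "a\<^sup>2 = D * b\<^sup>2" by (simp only: of_int_eq_iff)
  have "a\<^sup>2 * 1 = D * b\<^sup>2" using eq by (simp only: mult_1_right)
  then have "b\<^sup>2 dvd 1" by (rule int_square_dvd_imp_dvd[OF ab(2)])
  then have "b\<^sup>2 = 1" by (metis abs_power2 zdvd1_eq)
  then have "a\<^sup>2 = D" using eq by (simp only: mult_1_right)
  then have "a\<^sup>2 dvd D" by (simp only: dvd_refl)
  then have "a dvd 1" by (rule squarefreeD[OF sqfree])
  then have "a\<^sup>2 = 1" by (metis power2_abs one_power2 zdvd1_eq)
  with \<open>a\<^sup>2 = D\<close> D_neq_1 show False by (simp only: simp_thms)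
qed

text \<open>Coordinates in the basis \<open>1, s\<close>. The simp rules below turn computations in
  the field into rational arithmetic.\<close>

definition el :: "rat \<Rightarrow> rat \<Rightarrow> 'a" where
  "el p q = of_rat p + of_rat q * s"

definition K :: "'a set" where
  "K = {x. \<exists>p q. x = el p q}"

lemma el_in_K [simp]: "el p q \<in> K"
  by (auto simp: K_def)

text \<open>Linear independence of 1 and \<open>s\<close>: otherwise \<open>s\<close> would be a
  quotient of rationals.\<close>

lemma el_eq_iff [simp]: "el p q = el p' q' \<longleftrightarrow> p = p' \<and> q = q'"
proof
  assume eq: "el p q = el p' q'"
  then have *: "of_rat (q - q') * s = of_rat (p' - p)"
    by (simp add: el_def of_rat_diff algebra_simps)
  have "q = q'"
  proof (rule ccontr)
    assume "q \<noteq> q'"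
    then have "of_rat (q - q') \<noteq> (0 :: 'a)" by simp
    then have "s = of_rat (p' - p) / of_rat (q - q')"
      unfolding *[symmetric] by simp
    then have "s = of_rat ((p' - p) / (q - q'))"
      by (simp only: of_rat_divide)
    then show False using s_notin_Rats Rats_of_rat by metis
  qed
  moreover have "p = p'"
    using eq unfolding \<open>q = q'\<close> el_def by simp
  ultimately show "p = p' \<and> q = q'" by simp
qed simp

lemma el_eq_0_iff [simp]: "el p q = 0 \<longleftrightarrow> p = 0 \<and> q = 0"
proof -
  have "0 = el 0 0" by (simp add: el_def)
  then show ?thesis using el_eq_iff[of p q 0 0] by metis
qed

lemma el_add [simp]: "el p q + el p' q' = el (p + p') (q + q')"
  by (simp add: el_def of_rat_add algebra_simps)

lemma el_mult [simp]: "el p q * el p' q' = el (p * p' + of_int D * q * q') (p * q' + q * p')"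
proof -
  have "el p q * el p' q' = of_rat p * of_rat p' + of_rat q * of_rat q' * (s * s)
      + (of_rat p * of_rat q' + of_rat q * of_rat p') * s"
    unfolding el_def by (simp only: algebra_simps)
  also have "\<dots> = el (p * p' + of_int D * q * q') (p * q' + q * p')"
    unfolding s_mult_s by (simp add: el_def of_rat_add of_rat_mult mult_ac)
  finally show ?thesis .
qed

lemma el_uminus [simp]: "- el p q = el (- p) (- q)"
  by (simp add: el_def of_rat_minus)

lemma el_diff [simp]: "el p q - el p' q' = el (p - p') (q - q')"
  by (simp add: el_def of_rat_diff algebra_simps)

lemma of_rat_eq_el: "of_rat p = el p 0"
  by (simp add: el_def)

lemma of_int_eq_el: "of_int m = el (of_int m) 0"
  by (simp add: el_def)

lemma s_eq_el: "s = el 0 1"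
  by (simp add: el_def)

lemma KE: assumes "x \<in> K" obtains p q where "x = el p q"
  using assms by (auto simp: K_def)

lemma K_add: "x \<in> K \<Longrightarrow> y \<in> K \<Longrightarrow> x + y \<in> K"
  and K_mult: "x \<in> K \<Longrightarrow> y \<in> K \<Longrightarrow> x * y \<in> K"
  and K_diff: "x \<in> K \<Longrightarrow> y \<in> K \<Longrightarrow> x - y \<in> K"
  and K_uminus: "x \<in> K \<Longrightarrow> - x \<in> K"
  by (auto elim!: KE)

lemma K_of_rat [simp]: "of_rat p \<in> K"
  by (simp add: of_rat_eq_el)

lemma K_of_int [simp]: "of_int m \<in> K"
  by (simp add: of_int_eq_el)

text \<open>The nontrivial automorphism of \<open>K\<close>. It is well defined by
  \<open>el_eq_iff\<close>; outside \<open>K\<close> its value is unspecified, hence the membership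
  assumptions in the rules below.\<close>

definition cj :: "'a \<Rightarrow> 'a" where
  "cj x = (THE y. \<exists>p q. x = el p q \<and> y = el p (- q))"

lemma cj_el [simp]: "cj (el p q) = el p (- q)"
  unfolding cj_def by (rule the_equality) auto

lemma cj_in_K: "x \<in> K \<Longrightarrow> cj x \<in> K"
  by (auto elim!: KE)

lemma cj_cj: "x \<in> K \<Longrightarrow> cj (cj x) = x"
  by (auto elim!: KE)

lemma cj_add: "x \<in> K \<Longrightarrow> y \<in> K \<Longrightarrow> cj (x + y) = cj x + cj y"
  and cj_mult: "x \<in> K \<Longrightarrow> y \<in> K \<Longrightarrow> cj (x * y) = cj x * cj y"
  and cj_diff: "x \<in> K \<Longrightarrow> y \<in> K \<Longrightarrow> cj (x - y) = cj x - cj y"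
  by (auto elim!: KE)

lemma cj_of_int [simp]: "cj (of_int m) = of_int m"
  by (simp add: of_int_eq_el)

lemma cj_power: "x \<in> K \<Longrightarrow> cj (x ^ k) = cj x ^ k \<and> x ^ k \<in> K"
  using cj_of_int[of 1] K_of_int[of 1]
  by (induction k) (auto simp: cj_mult K_mult simp del: cj_of_int K_of_int)

lemma el_0_in_Rats [simp]: "el p 0 \<in> \<rat>"
  by (simp add: el_def)

lemma cj_eq_self_imp_Rats: "x \<in> K \<Longrightarrow> cj x = x \<Longrightarrow> x \<in> \<rat>"
  by (auto elim!: KE)

lemma norm_in_Rats: "x \<in> K \<Longrightarrow> x * cj x \<in> \<rat>"
  and trace_in_Rats: "x \<in> K \<Longrightarrow> x + cj x \<in> \<rat>"
  by (auto elim!: KE simp: mult.commute)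

lemma subfield_K: "subfield_of K"
  unfolding subfield_of_def
proof (intro conjI ballI)
  fix x assume x: "x \<in> K"
  show "inverse x \<in> K"
  proof (cases "x = 0")
    case False
    \<comment> \<open>The inverse is the conjugate divided by the norm, which is a nonzero
      rational.\<close>
    obtain r where r: "x * cj x = of_rat r"
      using norm_in_Rats[OF x] by (rule Rats_cases)
    have "cj x \<noteq> 0" using False x by (auto elim!: KE)
    with r False have "of_rat r \<noteq> (0 :: 'a)" by (metis mult_eq_0_iff)
    then have "x * (cj x * of_rat (inverse r)) = 1"
      by (simp add: of_rat_inverse r flip: mult.assoc)
    then have "inverse x = cj x * of_rat (inverse r)" by (rule inverse_unique)
    then show ?thesis using x by (simp add: K_mult cj_in_K)
  qed (use K_of_int[of 0] in simp)
qed (use K_of_int[of 0] K_of_int[of 1] in \<open>auto simp: K_add K_mult K_uminus\<close>)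

lemma K_divide: "x \<in> K \<Longrightarrow> y \<in> K \<Longrightarrow> x / y \<in> K"
  unfolding divide_inverse using subfield_K[unfolded subfield_of_def] by blast

lemma rat_adjoin_eq_K: "rat_adjoin s = K"
proof
  have "s \<in> K" using s_eq_el el_in_K by metis
  then show "rat_adjoin s \<subseteq> K"
    using subfield_K unfolding rat_adjoin_def by blast
  show "K \<subseteq> rat_adjoin s"
    unfolding rat_adjoin_def
  proof safe
    fix x L assume x: "x \<in> K" and L: "subfield_of L" and sL: "s \<in> L"
    obtain p q where "x = el p q" using x by (rule KE)
    then show "x \<in> L"
      unfolding el_def using subfield_of_of_rat[OF L] L sL by (simp add: subfield_of_def)
  qed
qed


subsection \<open>Integers of a quadratic field\<close>

text \<open>The order generated by \<open>s\<close>. It can be smaller than the ring of integers,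
  but it is visibly a ring and suffices to measure denominators.\<close>

definition lat :: "'a set" where
  "lat = {x. \<exists>a b :: int. x = of_int a + of_int b * s}"

lemma lat_of_int [simp]: "of_int a \<in> lat"
  unfolding lat_def by (rule CollectI, rule exI[of _ a], rule exI[of _ 0]) simp

lemma lat_add: assumes "x \<in> lat" "y \<in> lat" shows "x + y \<in> lat"
proof -
  obtain a b c d where "x = of_int a + of_int b * s" "y = of_int c + of_int d * s"
    using assms by (auto simp: lat_def)
  then have "x + y = of_int (a + c) + of_int (b + d) * s" by (simp add: algebra_simps)
  then show ?thesis unfolding lat_def by blast
qed

lemma lat_mult: assumes "x \<in> lat" "y \<in> lat" shows "x * y \<in> lat"
proof -
  obtain a b c d where "x = of_int a + of_int b * s" "y = of_int c + of_int d * s"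
    using assms by (auto simp: lat_def)
  then have "x * y = of_int (a * c) + of_int (b * d) * (s * s) + of_int (a * d + b * c) * s"
    by (simp add: algebra_simps)
  then have "x * y = of_int (a * c + b * d * D) + of_int (a * d + b * c) * s"
    by (simp add: s_mult_s)
  then show ?thesis unfolding lat_def by blast
qed

lemma lat_sum: "(\<And>i. i \<in> A \<Longrightarrow> f i \<in> lat) \<Longrightarrow> sum f A \<in> lat"
  using lat_of_int[of 0] by (induction A rule: infinite_finite_induct) (auto simp: lat_add)

lemma lat_power: "x \<in> lat \<Longrightarrow> x ^ k \<in> lat"
  using lat_of_int[of 1] by (induction k) (auto simp: lat_mult)

lemma lat_Rats: assumes "x \<in> lat" "x \<in> \<rat>" shows "x \<in> \<int>"
proof -
  obtain a b where ab: "x = of_int a + of_int b * s" using assms by (auto simp: lat_def)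
  obtain r where r: "x = of_rat r" using assms by (auto elim: Rats_cases)
  have "el (of_int a) (of_int b) = el r 0"
    using ab r by (simp add: el_def)
  then show ?thesis using ab by simp
qed

lemma cj_lat: assumes "x \<in> lat" shows "cj x \<in> lat"
proof -
  obtain a b where ab: "x = of_int a + of_int b * s" using assms by (auto simp: lat_def)
  then have "x = el (of_int a) (of_int b)" by (simp add: el_def)
  then have "cj x = el (of_int a) (of_int (- b))" by simp
  then have "cj x = of_int a + of_int (- b) * s" by (simp only: el_def of_rat_of_int_eq)
  then show ?thesis unfolding lat_def by blast
qed

text \<open>
  Integrality is tested by bounded denominators of the powers: unlike monic equations,
  this property is visibly stable under sums, products and conjugation.
\<close>

definition bounded_denom :: "'a \<Rightarrow> bool" where
  "bounded_denom x \<longleftrightarrow> (\<exists>M::int. M \<noteq> 0 \<and> (\<forall>k. of_int M * x ^ k \<in> lat))"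

lemma bounded_denom_mult:
  assumes "bounded_denom x" "bounded_denom y"
  shows "bounded_denom (x * y)"
proof -
  obtain M N where M: "M \<noteq> 0" "\<And>k. of_int M * x ^ k \<in> lat" and N: "N \<noteq> 0" "\<And>k. of_int N * y ^ k \<in> lat"
    using assms by (auto simp: bounded_denom_def)
  have "of_int (M * N) * (x * y) ^ k \<in> lat" for k
    using lat_mult[OF M(2)[of k] N(2)[of k]] by (simp add: power_mult_distrib mult_ac)
  then show ?thesis using M N unfolding bounded_denom_def by (intro exI[of _ "M * N"]) auto
qed

text \<open>The product \<open>M * N\<close> clears every mixed term of the binomial expansion at
  once.\<close>

lemma bounded_denom_add:
  assumes "bounded_denom x" "bounded_denom y"
  shows "bounded_denom (x + y)"
proof -
  obtain M N where M: "M \<noteq> 0" "\<And>k. of_int M * x ^ k \<in> lat" and N: "N \<noteq> 0" "\<And>k. of_int N * y ^ k \<in> lat"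
    using assms by (auto simp: bounded_denom_def)
  have "of_int (M * N) * (x + y) ^ k \<in> lat" for k
  proof -
    have "of_int (M * N) * (x + y) ^ k =
        (\<Sum>i\<le>k. of_int (int (k choose i)) * ((of_int M * x ^ i) * (of_int N * y ^ (k - i))))"
      by (simp add: binomial_ring sum_distrib_left mult_ac)
    also have "\<dots> \<in> lat"
      by (intro lat_sum lat_mult M N lat_of_int)
    finally show ?thesis .
  qed
  then show ?thesis using M N unfolding bounded_denom_def by (intro exI[of _ "M * N"]) auto
qed

lemma bounded_denom_cj:
  assumes "x \<in> K" "bounded_denom x"
  shows "bounded_denom (cj x)"
proof -
  obtain M where M: "M \<noteq> 0" "\<And>k. of_int M * x ^ k \<in> lat"
    using assms by (auto simp: bounded_denom_def)
  have "of_int M * cj x ^ k \<in> lat" for k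
    using cj_lat[OF M(2)[of k]] cj_power[OF assms(1), of k] by (simp add: cj_mult)
  then show ?thesis using M unfolding bounded_denom_def by (intro exI[of _ "M"]) auto
qed

lemma bounded_denom_Rats:
  assumes "x \<in> \<rat>" "bounded_denom x"
  shows "x \<in> \<int>"
proof -
  obtain M where M: "M \<noteq> 0" "\<And>k. of_int M * x ^ k \<in> lat"
    using assms by (auto simp: bounded_denom_def)
  have "of_int M * x ^ k \<in> \<int>" for k
    using assms(1) by (intro lat_Rats M) auto
  then show ?thesis by (rule Rats_bounded_denominator_imp_Ints[OF assms(1) M(1)])
qed

text \<open>If \<open>m\<close> clears the denominators of \<open>x\<close> and the monic equation
  has degree \<open>n\<close>, then \<open>m ^ n\<close> clears all powers: directly for exponents
  below \<open>n\<close>, and from \<open>n\<close> on by lowering the exponent with the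
  equation.\<close>

lemma algebraic_int_imp_bounded_denom:
  assumes "x \<in> K" "algebraic_int x"
  shows "bounded_denom x"
proof -
  obtain P where P: "lead_coeff P = 1" "\<forall>i. coeff P i \<in> \<int>" "poly P x = 0"
    using assms(2) by (auto simp: algebraic_int.simps)
  define n where "n = degree P"
  obtain p q where pq: "x = el p q" using assms(1) by (rule KE)
  obtain a b where p: "p = of_int a / of_int b" "b \<noteq> 0"
    by (cases p) (auto simp: Fract_of_int_quotient)
  obtain c e where q: "q = of_int c / of_int e" "e \<noteq> 0"
    by (cases q) (auto simp: Fract_of_int_quotient)
  define m where "m = b * e"
  have bp: "of_int b * of_rat p = (of_int a :: 'a)" and eq: "of_int e * of_rat q = (of_int c :: 'a)"
    using p q by (simp_all add: of_rat_divide)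
  have "of_int m * x = of_int e * (of_int b * of_rat p) + of_int b * (of_int e * of_rat q) * s"
    by (simp add: pq el_def m_def algebra_simps)
  also have "\<dots> = of_int (e * a) + of_int (b * c) * s"
    unfolding bp eq by simp
  finally have mx: "of_int m * x \<in> lat" unfolding lat_def by blast
  have recursion: "x ^ n = - (\<Sum>i<n. coeff P i * x ^ i)"
  proof -
    have "0 = (\<Sum>i\<le>n. coeff P i * x ^ i)"
      using P(3) by (simp add: poly_altdef n_def)
    also have "\<dots> = (\<Sum>i<n. coeff P i * x ^ i) + x ^ n"
      using P(1) by (simp add: n_def lessThan_Suc_atMost[symmetric])
    finally show ?thesis by (simp add: eq_neg_iff_add_eq_0 add.commute)
  qed
  have "of_int (m ^ n) * x ^ k \<in> lat" for k
  proof (induction k rule: less_induct)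
    case (less k)
    show ?case
    proof (cases "k < n")
      case True
      then have "of_int (m ^ n) * x ^ k = of_int (m ^ (n - k)) * (of_int m * x) ^ k"
        by (simp add: power_mult_distrib flip: power_add mult.assoc)
      then show ?thesis by (simp only: lat_mult lat_of_int lat_power mx)
    next
      case False
      then have "x ^ k = x ^ (k - n) * x ^ n" by (simp flip: power_add)
      also have "\<dots> = - (\<Sum>i<n. coeff P i * x ^ (k - n + i))"
        by (simp add: recursion sum_distrib_left power_add mult_ac)
      finally have "of_int (m ^ n) * x ^ k =
          (\<Sum>i<n. of_int (- 1) * coeff P i * (of_int (m ^ n) * x ^ (k - n + i)))"
        by (simp add: sum_distrib_left sum_negf mult_ac)
      also have "\<dots> \<in> lat"
      proof (rule lat_sum)
        fix i assume "i \<in> {..<n}"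
        then have "of_int (m ^ n) * x ^ (k - n + i) \<in> lat"
          using False by (intro less) auto
        moreover have "coeff P i \<in> \<int>" using P(2) by simp
        then have "coeff P i \<in> lat" by (rule Ints_cases) simp
        ultimately show "of_int (- 1) * coeff P i * (of_int (m ^ n) * x ^ (k - n + i)) \<in> lat"
          by (intro lat_mult[OF lat_mult[OF lat_of_int]])
      qed
      finally show ?thesis .
    qed
  qed
  moreover have "m ^ n \<noteq> 0" using p q by (simp add: m_def)
  ultimately show ?thesis unfolding bounded_denom_def by blast
qed

lemma trace_norm_in_Ints:
  assumes "x \<in> K" "bounded_denom x"
  shows "x + cj x \<in> \<int>" "x * cj x \<in> \<int>"
  by (intro bounded_denom_Rats trace_in_Rats norm_in_Rats bounded_denom_add bounded_denom_mult
    bounded_denom_cj assms)+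

abbreviation OK :: "'a set" where
  "OK \<equiv> ring_of_integers K"

text \<open>For the inclusion still open, trace \<open>t\<close> and norm \<open>m\<close> are
  rational with bounded denominators, hence integers, and \<open>x\<close> is a root of
  \<open>X^2 - t * X + m\<close>.\<close>

lemma OK_eq: "OK = {x \<in> K. bounded_denom x}"
proof -
  have "algebraic_int x" if x: "x \<in> K" "bounded_denom x" for x
  proof -
    obtain t where t: "x + cj x = of_int t"
      using trace_norm_in_Ints[OF x] by (auto elim: Ints_cases)
    obtain m where m: "x * cj x = of_int m"
      using trace_norm_in_Ints[OF x] by (auto elim: Ints_cases)
    have "of_int m + x * (x - of_int t) = 0"
      by (simp flip: t m add: algebra_simps)
    then have "poly [:of_int m, - of_int t, 1:] x = 0"
      by (simp add: algebra_simps)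
    then show ?thesis
      by (intro algebraic_int.intros[of "[:of_int m, - of_int t, 1:]"])
        (auto simp: coeff_pCons split: nat.splits)
  qed
  then show ?thesis
    using algebraic_int_imp_bounded_denom by (auto simp: ring_of_integers_def)
qed

section \<open>Ring structure, units, norms and irrational parts of integers\<close>

lemma OK_subset_K: "x \<in> OK \<Longrightarrow> x \<in> K"
  by (simp add: ring_of_integers_def)

lemma OK_of_int [simp]: "of_int m \<in> OK"
  by (simp add: ring_of_integers_def)

lemma OK_add: "x \<in> OK \<Longrightarrow> y \<in> OK \<Longrightarrow> x + y \<in> OK"
  and OK_mult: "x \<in> OK \<Longrightarrow> y \<in> OK \<Longrightarrow> x * y \<in> OK"
  and OK_cj: "x \<in> OK \<Longrightarrow> cj x \<in> OK"
  by (simp_all add: OK_eq K_add K_mult cj_in_K bounded_denom_add bounded_denom_mult bounded_denom_cj)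

lemma OK_uminus: "x \<in> OK \<Longrightarrow> - x \<in> OK"
  using OK_mult[OF OK_of_int[of "- 1"]] by simp

lemma OK_diff: "x \<in> OK \<Longrightarrow> y \<in> OK \<Longrightarrow> x - y \<in> OK"
  using OK_add[OF _ OK_uminus] by simp

lemma OK_power: "x \<in> OK \<Longrightarrow> x ^ k \<in> OK"
  using OK_of_int[of 1] by (induction k) (auto simp: OK_mult)

lemma OK_numeral [simp]: "numeral k \<in> OK" "1 \<in> OK" "0 \<in> OK"
  using OK_of_int[of "numeral k"] OK_of_int[of 1] OK_of_int[of 0] by auto

lemma OK_sum: "(\<And>i. i \<in> A \<Longrightarrow> f i \<in> OK) \<Longrightarrow> sum f A \<in> OK"
  by (induction A rule: infinite_finite_induct) (auto simp: OK_add)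

lemma OK_prod: "(\<And>i. i \<in> A \<Longrightarrow> f i \<in> OK) \<Longrightarrow> prod f A \<in> OK"
  by (induction A rule: infinite_finite_induct) (auto simp: OK_mult)

lemma OK_Rats: "x \<in> OK \<Longrightarrow> x \<in> \<rat> \<Longrightarrow> x \<in> \<int>"
  by (simp add: OK_eq bounded_denom_Rats)

text \<open>Integral closedness for square roots. It carries the roots later found in
  \<open>K\<close> over to the ring of integers.\<close>

lemma OK_sqrt: assumes "x \<in> K" "x\<^sup>2 \<in> OK" shows "x \<in> OK"
proof -
  have "algebraic_int x"
    by (rule algebraic_int_root[of "x\<^sup>2" "monom 1 2"])
      (use assms in \<open>auto simp: ring_of_integers_def poly_monom degree_monom_eq\<close>)
  then show ?thesis using assms by (simp add: ring_of_integers_def)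
qed

text \<open>Such an \<open>x\<close> is rational, hence a rational integer. That 2, 3 and
  \<open>d\<close> are not units later excludes the degenerate cases.\<close>

lemma not_OK_inverse: assumes "x \<in> OK" "of_int m * x = 1" shows "\<bar>m\<bar> = 1"
proof -
  have "of_int m \<noteq> (0 :: 'a)" using assms by auto
  then have "x = 1 / of_int m" using assms(2) by (simp add: field_simps)
  then have "x \<in> \<rat>" by simp
  then obtain k where "x = of_int k" using OK_Rats assms by (auto elim: Ints_cases)
  then have "(of_int (m * k) :: 'a) = of_int 1" using assms by simp
  then have "m * k = 1" by (simp only: of_int_eq_iff)
  then show ?thesis using abs_zmult_eq_1[of m k] by simp
qed

lemma norm_obtains: assumes "x \<in> OK" obtains m where "x * cj x = of_int m"
  using trace_norm_in_Ints(2)[of x] assms by (auto simp: OK_eq elim: Ints_cases)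

lemma trace_obtains: assumes "x \<in> OK" obtains m where "x + cj x = of_int m"
  using trace_norm_in_Ints(1)[of x] assms by (auto simp: OK_eq elim: Ints_cases)

lemma OK_cj_fixed: "x \<in> OK \<Longrightarrow> cj x = x \<Longrightarrow> x \<in> \<int>"
  by (intro OK_Rats cj_eq_self_imp_Rats OK_subset_K)

text \<open>Here \<open>x = q * s\<close> with rational \<open>q\<close>, and the norm
  \<open>- q^2 * D\<close> is an integer; as \<open>D\<close> is squarefree, \<open>q\<close> has no
  denominator.\<close>

lemma OK_cj_anti:
  assumes "x \<in> OK" "cj x = - x"
  obtains t :: int where "x = of_int t * s"
proof -
  obtain p q where pq: "x = el p q" using assms OK_subset_K by (blast elim: KE)
  have "p = 0" using assms(2) by (simp add: pq)
  then have x: "x = of_rat q * s" by (simp add: pq el_def)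
  obtain a b where q: "q = of_int a / of_int b" "b > 0" "coprime a b"
    by (cases q) (auto simp: Fract_of_int_quotient)
  obtain m where m: "x * cj x = of_int m" using assms(1) by (rule norm_obtains)
  have "of_int m = x * - x" using m assms(2) by simp
  also have "\<dots> = - (of_rat q * of_rat q * (s * s))"
    unfolding x by (simp add: mult_ac)
  finally have "of_int m = - (of_rat q * of_rat q * (s * s))" .
  then have "(of_int (m * b\<^sup>2) :: 'a) = of_int (- a\<^sup>2 * D)"
    using q by (simp add: s_mult_s of_rat_divide field_simps power2_eq_square)
  then have "m * b\<^sup>2 = - a\<^sup>2 * D" by (simp only: of_int_eq_iff)
  then have "a\<^sup>2 * D = (- m) * b\<^sup>2" by simp
  then have "b\<^sup>2 dvd D" by (rule int_square_dvd_imp_dvd[OF q(3)])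
  then have "b dvd 1" using sqfree squarefreeD by blast
  then have "b = 1" using q(2) by simp
  with q x that[of a] show ?thesis by simp
qed

text \<open>For \<open>x = p + q * s\<close> this is \<open>b = 2 * q\<close>, an integer even when
  \<open>p\<close> and \<open>q\<close> are half-integers.\<close>

lemma imag_obtains:
  assumes "x \<in> OK" obtains b :: int where "x - cj x = of_int b * s"
proof (rule OK_cj_anti)
  show "x - cj x \<in> OK" using assms by (simp add: OK_diff OK_cj)
  show "cj (x - cj x) = - (x - cj x)"
    using OK_subset_K[OF assms] by (simp add: cj_diff cj_in_K cj_cj)
qed

lemma Ints_if_imag_eq_0: "x \<in> OK \<Longrightarrow> x - cj x = 0 \<Longrightarrow> x \<in> \<int>"
  by (rule OK_cj_fixed) auto

lemma of_int_mult_s_eq_0_iff: "of_int b * s = 0 \<longleftrightarrow> b = 0"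
  using s_notin_Rats by auto

text \<open>The reason for the factors \<open>2 * a i ^ 2 + 1\<close> in \<open>weight\<close>. With
  trace \<open>t\<close> and norm \<open>n\<close> of \<open>x\<close>, one has
  \<open>m = (2 * n - 1)^2 + 2 * t^2\<close> and \<open>b^2 * D = t^2 - 4 * n\<close>, so
  \<open>m\<close> controls \<open>b\<close>; it is positive because \<open>2 * n - 1\<close> is
  odd.\<close>

lemma imag_bound:
  assumes x: "x \<in> OK" and b: "x - cj x = of_int b * s"
    and m: "(2 * x\<^sup>2 + 1) * cj (2 * x\<^sup>2 + 1) = of_int m"
  shows "b\<^sup>2 \<le> 4 * m" "m \<ge> 1"
proof -
  obtain t where t: "x + cj x = of_int t" using x by (rule trace_obtains)
  obtain n where n: "x * cj x = of_int n" using x by (rule norm_obtains)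
  have xK: "x \<in> K" using x by (rule OK_subset_K)
  have "cj (2 * x\<^sup>2 + 1) = 2 * (cj x)\<^sup>2 + 1"
    using cj_add[of "of_int 2 * x\<^sup>2" "of_int 1"] cj_mult[of "of_int 2" "x\<^sup>2"] cj_power[OF xK, of 2]
    by (simp add: K_mult del: K_of_int cj_of_int)
      (metis K_mult K_of_int cj_of_int of_int_1 of_int_numeral)
  then have "of_int m = (2 * x\<^sup>2 + 1) * (2 * (cj x)\<^sup>2 + 1)"
    using m by simp
  also have "\<dots> = (2 * (x * cj x) - 1)\<^sup>2 + 2 * (x + cj x)\<^sup>2"
    by algebra
  also have "\<dots> = of_int ((2 * n - 1)\<^sup>2 + 2 * t\<^sup>2)"
    by (simp add: t n)
  finally have m': "m = (2 * n - 1)\<^sup>2 + 2 * t\<^sup>2" by (simp only: of_int_eq_iff)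
  have "of_int (b\<^sup>2 * D) = (x - cj x)\<^sup>2"
    unfolding b by (simp add: power_mult_distrib s2)
  also have "\<dots> = (x + cj x)\<^sup>2 - 4 * (x * cj x)" by algebra
  also have "\<dots> = of_int (t\<^sup>2 - 4 * n)" by (simp add: t n)
  finally have bD: "b\<^sup>2 * D = t\<^sup>2 - 4 * n" by (simp only: of_int_eq_iff)
  have n1: "\<bar>n\<bar> \<le> (2 * n - 1)\<^sup>2"
  proof -
    have "\<bar>n\<bar> \<le> \<bar>2 * n - 1\<bar>" by linarith
    also have "\<dots> \<le> \<bar>2 * n - 1\<bar> * \<bar>2 * n - 1\<bar>"
    proof -
      have "1 \<le> \<bar>2 * n - 1\<bar>" by presburger
      from mult_left_mono[OF this, of "\<bar>2 * n - 1\<bar>"] show ?thesis by simp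
    qed
    also have "\<dots> = (2 * n - 1)\<^sup>2" by (simp add: power2_eq_square flip: abs_mult)
    finally show ?thesis .
  qed
  have "b\<^sup>2 * 1 \<le> b\<^sup>2 * \<bar>D\<bar>"
    using D_neq_0 by (intro mult_left_mono) auto
  also have "\<dots> = \<bar>t\<^sup>2 - 4 * n\<bar>" by (simp flip: bD add: abs_mult)
  also have "\<dots> \<le> t\<^sup>2 + 4 * \<bar>n\<bar>"
    using zero_le_power2[of t] by linarith
  also have "\<dots> \<le> 4 * m"
    using n1 zero_le_power2[of t] m' by linarith
  finally show "b\<^sup>2 \<le> 4 * m" by simp
  have "2 * n - 1 \<noteq> 0" by presburger
  then have "(2 * n - 1)\<^sup>2 > 0" by simp
  then show "m \<ge> 1" using m' zero_le_power2[of t] by linarith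
qed

text \<open>A positive nonsquare, so the Pell equation has nontrivial solutions in the rational
  integers. The product \<open>d * D\<close> is \<open>D^2\<close> or at most \<open>- 3\<close>,
  which is what excludes irrational solutions.\<close>

definition d :: int where
  "d = (if D > 0 then D else 3)"

lemma d_ge_2: "d \<ge> 2"
  using D_neq_0 D_neq_1 by (auto simp: d_def)

text \<open>
  With \<open>'\<close> for conjugation, the rational integers \<open>a = x x' - d y y'\<close> and \<open>b = (y x' - x y') / s\<close>
  satisfy \<open>a\<^sup>2 - d D b\<^sup>2 = 1\<close>, where \<open>d D\<close> is either a square or less than \<open>- 1\<close>. Hence \<open>b = 0\<close>
  and conjugation acts on \<open>(x, y)\<close> as the sign \<open>a\<close>.
\<close>

lemma pell_solution_in_Ints:
  assumes x: "x \<in> OK" and y: "y \<in> OK" and pell: "x\<^sup>2 = 1 + of_int d * y\<^sup>2"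
  shows "x \<in> \<int>" "y \<in> \<int>"
proof -
  have xK: "x \<in> K" and yK: "y \<in> K" using x y by (auto dest: OK_subset_K)
  obtain a1 where a1: "x * cj x = of_int a1" using x by (rule norm_obtains)
  obtain a2 where a2: "y * cj y = of_int a2" using y by (rule norm_obtains)
  define a where "a = a1 - d * a2"
  have a: "of_int a = x * cj x - of_int d * (y * cj y)" by (simp add: a_def a1 a2)
  obtain b where b: "y * cj x - x * cj y = of_int b * s"
  proof (rule OK_cj_anti)
    show "y * cj x - x * cj y \<in> OK"
      using x y by (simp add: OK_diff OK_mult OK_cj)
    show "cj (y * cj x - x * cj y) = - (y * cj x - x * cj y)"
      using xK yK by (simp add: cj_diff cj_mult K_mult cj_in_K cj_cj)
  qed
  have "cj (x\<^sup>2) = cj (1 + of_int d * y\<^sup>2)" using pell by simp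
  also have "\<dots> = 1 + of_int d * (cj y)\<^sup>2"
    using cj_add[of "of_int 1" "of_int d * y\<^sup>2"] cj_mult[of "of_int d" "y\<^sup>2"] cj_power[OF yK, of 2]
      cj_of_int[of 1] K_of_int[of 1] by (simp add: K_mult del: cj_of_int) simp
  finally have pell': "(cj x)\<^sup>2 = 1 + of_int d * (cj y)\<^sup>2"
    using cj_power[OF xK, of 2] by simp
  have "(of_int (a\<^sup>2 - d * D * b\<^sup>2) :: 'a) = (of_int a)\<^sup>2 - of_int d * (of_int b * s)\<^sup>2"
    by (simp add: power_mult_distrib s2)
  also have "\<dots> = (x\<^sup>2 - of_int d * y\<^sup>2) * ((cj x)\<^sup>2 - of_int d * (cj y)\<^sup>2)"
    unfolding a b[symmetric] by algebra
  also have "\<dots> = of_int 1" by (simp add: pell pell')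
  finally have ab: "a\<^sup>2 - d * D * b\<^sup>2 = 1" by (simp only: of_int_eq_iff)
  have "b = 0"
  proof (cases "D > 0")
    case True
    \<comment> \<open>Here \<open>d * D = D^2\<close>, so the equation factors; two integers with
      product 1 are equal.\<close>
    then have "(a - D * b) * (a + D * b) = 1"
      using ab by (simp add: d_def algebra_simps power2_eq_square)
    then have "a - D * b = a + D * b"
      by (metis mult.commute zmult_eq_1_iff)
    then show ?thesis using D_neq_0 by simp
  next
    case False
    then have "a\<^sup>2 + 3 * (- D) * b\<^sup>2 = 1" using ab by (simp add: d_def)
    moreover have "1 * b\<^sup>2 \<le> (- D) * b\<^sup>2"
      using False D_neq_0 by (intro mult_right_mono) auto
    ultimately have "3 * b\<^sup>2 \<le> 1" using zero_le_power2[of a] by linarith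
    then have "b\<^sup>2 \<le> 0" by linarith
    then show ?thesis by simp
  qed
  then have a_sq: "a = 1 \<or> a = - 1" using ab by (simp add: power2_eq_1_iff)
  have yx: "y * cj x = x * cj y" using b \<open>b = 0\<close> by simp
  have cjx: "cj x = of_int a * x"
  proof -
    \<comment> \<open>The factor in brackets is 1; exchanging \<open>y * cj x\<close> for
      \<open>x * cj y\<close> then brings out \<open>a\<close>.\<close>
    have "cj x = cj x * (x\<^sup>2 - of_int d * y\<^sup>2)" by (simp add: pell)
    also have "\<dots> = x * (x * cj x) - of_int d * y * (y * cj x)" by algebra
    also have "\<dots> = of_int a * x" unfolding yx a by algebra
    finally show ?thesis .
  qed
  have cjy: "cj y = of_int a * y"
  proof -
    have "cj y = cj y * (x\<^sup>2 - of_int d * y\<^sup>2)" by (simp add: pell)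
    also have "\<dots> = x * (x * cj y) - of_int d * y * (y * cj y)" by algebra
    also have "\<dots> = of_int a * y" unfolding yx[symmetric] a by algebra
    finally show ?thesis .
  qed
  have "a = 1"
  proof (rule ccontr)
    assume "a \<noteq> 1"
    then have a: "a = - 1" using a_sq by simp
    obtain t where t: "x = of_int t * s" using OK_cj_anti[OF x] cjx a by auto
    obtain t' where t': "y = of_int t' * s" using OK_cj_anti[OF y] cjy a by auto
    \<comment> \<open>If both \<open>x\<close> and \<open>y\<close> are multiples of
      \<open>s\<close>, then \<open>D\<close> divides 1, so \<open>D = - 1\<close> and
      \<open>d = 3\<close>. But 2 is not a square modulo 3.\<close>
    have "(of_int (t\<^sup>2 * D) :: 'a) = of_int (1 + d * (t'\<^sup>2 * D))"
      using pell by (simp add: t t' power_mult_distrib s2)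
    then have eq: "t\<^sup>2 * D = 1 + d * (t'\<^sup>2 * D)" by (simp only: of_int_eq_iff)
    then have "D * (t\<^sup>2 - d * t'\<^sup>2) = 1" by (simp add: algebra_simps)
    then have "D = - 1" using D_neq_1 zmult_eq_1_iff by blast
    then have "d = 3" unfolding d_def by simp
    from eq[unfolded this, unfolded \<open>D = - 1\<close>] have "t\<^sup>2 = 3 * t'\<^sup>2 - 1" by simp
    then have "t\<^sup>2 mod 3 = 2" by presburger
    moreover have "t mod 3 = 0 \<or> t mod 3 = 1 \<or> t mod 3 = 2" by presburger
    then have "t\<^sup>2 mod 3 = 0 \<or> t\<^sup>2 mod 3 = 1"
      by (auto simp: power2_eq_square mod_mult_eq[of t 3 t, symmetric])
    ultimately show False by auto
  qed
  then show "x \<in> \<int>" "y \<in> \<int>" using cjx cjy x y by (auto intro: OK_cj_fixed)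
qed

end


section \<open>Pell equations over the integers\<close>

text \<open>Dirichlet's argument: infinitely many good approximations \<open>h / k\<close> of the
  square root \<theta> give elements \<open>h + k * \<theta>\<close> of bounded norm. Two of them
  that agree in norm and in both residues modulo the norm have a quotient with integral coordinates
  and norm 1.\<close>

lemma int_pell_exists:
  fixes N :: int
  assumes pos: "N > 0" and nonsquare: "\<And>k. k\<^sup>2 \<noteq> N"
  obtains x y where "x\<^sup>2 = 1 + N * y\<^sup>2" "y \<noteq> 0"
proof -
  define \<theta> where "\<theta> = sqrt (of_int N)"
  have \<theta>_sq: "\<theta>\<^sup>2 = of_int N" and \<theta>_pos: "\<theta> \<ge> 0"
    using pos by (simp_all add: \<theta>_def)
  have "\<theta> \<notin> \<rat>"
  proof
    assume "\<theta> \<in> \<rat>"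
    then obtain a b :: int where ab: "b > 0" "coprime a b" "\<theta> = of_int a / of_int b"
      by (auto elim: Rats_cases')
    have "of_int N = (of_int a / of_int b :: real)\<^sup>2"
      using \<theta>_sq ab(3) by simp
    then have "(of_int (a\<^sup>2) :: real) = of_int (N * b\<^sup>2)"
      using ab(1) by (simp add: power_divide field_simps)
    then have eq: "a\<^sup>2 = N * b\<^sup>2" by (simp only: of_int_eq_iff)
    then have "a\<^sup>2 * 1 = N * b\<^sup>2" by (simp only: mult_1_right)
    then have "b\<^sup>2 dvd 1" by (rule int_square_dvd_imp_dvd[OF ab(2)])
    then have "b\<^sup>2 = 1" by (metis abs_power2 zdvd1_eq)
    then show False using eq nonsquare[of a] by (simp only: mult_1_right)
  qed
  then have inf: "infinite (approx_set \<theta>)"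
    by (simp add: rational_iff_finite_approx_set)
  define nrm where "nrm = (\<lambda>(h::int, k). h\<^sup>2 - N * k\<^sup>2)"
  define B where "B = \<lceil>2 * \<theta> + 1\<rceil>"
  \<comment> \<open>The norm is the product of \<open>h - k * \<theta>\<close>, which is below
    \<open>1 / k\<close> in absolute value, and \<open>h + k * \<theta>\<close>, which is at most
    \<open>1 + 2 * k * \<theta>\<close>.\<close>
  have nrm_bound: "nrm z \<in> {- B..B}" if "z \<in> approx_set \<theta>" for z
  proof -
    obtain h k where z: "z = (h, k)" by force
    have k: "k > 0" and hk: "\<bar>\<theta> - of_int h / of_int k\<bar> < 1 / (of_int k)\<^sup>2"
      using that by (auto simp: z approx_set_def)
    define e where "e = of_int h - of_int k * \<theta>"
    have k1: "(of_int k :: real) \<ge> 1" using k by simp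
    have "\<bar>e\<bar> = of_int k * \<bar>\<theta> - of_int h / of_int k\<bar>"
      using k by (simp add: e_def field_simps abs_minus_commute flip: abs_mult_pos)
    also have "\<dots> < of_int k * (1 / (of_int k)\<^sup>2)"
      using k hk by (intro mult_strict_left_mono) auto
    also have "\<dots> = 1 / of_int k" using k by (simp add: power2_eq_square)
    finally have e: "\<bar>e\<bar> < 1 / of_int k" .
    also have "1 / of_int k \<le> (1::real)" using k1 by simp
    finally have e1: "\<bar>e\<bar> \<le> 1" by simp
    have ke: "of_int k * \<bar>e\<bar> \<le> 1"
      using e k by (simp add: field_simps)
    have "of_int (nrm z) = (of_int h)\<^sup>2 - \<theta>\<^sup>2 * (of_int k)\<^sup>2"
      by (simp add: z nrm_def \<theta>_sq)
    also have "\<dots> = e * (e + 2 * of_int k * \<theta>)"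
      by (simp add: e_def power2_eq_square algebra_simps)
    finally have "\<bar>of_int (nrm z)\<bar> = \<bar>e\<bar> * \<bar>e + 2 * of_int k * \<theta>\<bar>"
      by (simp add: abs_mult)
    also have "\<dots> \<le> \<bar>e\<bar> * (1 + 2 * of_int k * \<theta>)"
    proof (rule mult_left_mono)
      have "0 \<le> 2 * of_int k * \<theta>" using k \<theta>_pos by simp
      then show "\<bar>e + 2 * of_int k * \<theta>\<bar> \<le> 1 + 2 * of_int k * \<theta>" using e1 by linarith
    qed simp
    also have "\<dots> = \<bar>e\<bar> + 2 * \<theta> * (of_int k * \<bar>e\<bar>)" by (simp add: algebra_simps)
    also have "\<dots> \<le> 1 + 2 * \<theta> * 1"
      using e1 ke \<theta>_pos by (intro add_mono mult_left_mono) auto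
    finally have "\<bar>of_int (nrm z)\<bar> \<le> 2 * \<theta> + 1" by simp
    also have "\<dots> \<le> of_int B" by (simp add: B_def)
    finally have "\<bar>nrm z\<bar> \<le> B" by linarith
    then show ?thesis by auto
  qed
  define f where "f = (\<lambda>z. (nrm z, fst z mod nrm z, snd z mod nrm z))"
  have "f ` approx_set \<theta> \<subseteq> {- B..B} \<times> {- B..B} \<times> {- B..B}"
  proof
    fix y assume "y \<in> f ` approx_set \<theta>"
    then obtain z where z: "z \<in> approx_set \<theta>" "y = f z" by auto
    have bound: "\<bar>c mod m\<bar> \<le> \<bar>m\<bar>" if "m \<noteq> 0" for c m :: int
      using abs_mod_less[OF that, of c] by linarith
    \<comment> \<open>A norm 0 would make \<theta> rational. It has to be excluded because residues
      modulo 0 are unbounded.\<close>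
    have "nrm z \<noteq> 0"
    proof
      obtain h k where hk: "z = (h, k)" by force
      assume "nrm z = 0"
      then have "(of_int h)\<^sup>2 = (of_int N * (of_int k)\<^sup>2 :: real)"
        unfolding nrm_def hk by (simp flip: of_int_power of_int_mult)
      then have "(of_int h / of_int k)\<^sup>2 = \<theta>\<^sup>2"
        using z hk by (auto simp: approx_set_def \<theta>_sq power_divide field_simps)
      then have "\<theta> = of_int h / of_int k \<or> \<theta> = - (of_int h / of_int k)"
        by (metis power2_eq_iff)
      with \<open>\<theta> \<notin> \<rat>\<close> show False by auto
    qed
    then show "y \<in> {- B..B} \<times> {- B..B} \<times> {- B..B}"
      using nrm_bound[OF z(1)] bound[of "nrm z" "fst z"] bound[of "nrm z" "snd z"]
      by (auto simp: z(2) f_def)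
  qed
  then have "finite (f ` approx_set \<theta>)" by (rule finite_subset) auto
  from pigeonhole_infinite[OF inf this] obtain z where z: "z \<in> approx_set \<theta>"
    and inf': "infinite {z' \<in> approx_set \<theta>. f z' = f z}" by auto
  have "\<exists>z'\<in>{z' \<in> approx_set \<theta>. f z' = f z}. z' \<noteq> z"
  proof (rule ccontr)
    assume "\<not> ?thesis"
    then have "{z' \<in> approx_set \<theta>. f z' = f z} \<subseteq> {z}" by auto
    with inf' show False using finite_subset by blast
  qed
  then obtain z' where z': "z' \<in> approx_set \<theta>" "f z' = f z" "z' \<noteq> z" by blast
  obtain h k where hk: "z = (h, k)" by force
  obtain h' k' where hk': "z' = (h', k')" by force
  define m where "m = nrm z"
  have m: "h\<^sup>2 - N * k\<^sup>2 = m" "h'\<^sup>2 - N * k'\<^sup>2 = m" and cong: "h' mod m = h mod m" "k' mod m = k mod m"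
    using z'(2) by (auto simp: f_def m_def hk hk' nrm_def)
  have kpos: "k > 0" "k' > 0" and cop: "coprime h k" "coprime h' k'"
    using z z'(1) by (auto simp: approx_set_def hk hk')
  have "m \<noteq> 0"
  proof
    assume "m = 0"
    with cong have "h' = h" "k' = k" by auto
    with z'(3) show False by (simp add: hk hk')
  qed
  have "m dvd h' - h" "m dvd k' - k"
    using cong by (simp_all add: mod_eq_dvd_iff)
  then obtain s t where s: "h' = h + m * s" and t: "k' = k + m * t"
    by (metis add.commute diff_eq_eq dvdE)
  \<comment> \<open>\<open>x + y * \<theta>\<close> is the quotient of
    \<open>h + k * \<theta>\<close> by \<open>h' + k' * \<theta>\<close>: multiply by the conjugate
    and divide by the norm \<open>m\<close>.\<close>
  define x where "x = 1 + h * s - N * k * t"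
  define y where "y = k * s - h * t"
  have x: "h * h' - N * k * k' = m * x"
    unfolding x_def s t m(1)[symmetric] by algebra
  have y: "k * h' - h * k' = m * y"
    unfolding y_def s t by algebra
  have "m\<^sup>2 * (x\<^sup>2 - N * y\<^sup>2) = (m * x)\<^sup>2 - N * (m * y)\<^sup>2" by algebra
  also have "\<dots> = (h\<^sup>2 - N * k\<^sup>2) * (h'\<^sup>2 - N * k'\<^sup>2)"
    unfolding x[symmetric] y[symmetric] by algebra
  also have "\<dots> = m\<^sup>2 * 1" unfolding m by (simp add: power2_eq_square)
  finally have "x\<^sup>2 - N * y\<^sup>2 = 1" using \<open>m \<noteq> 0\<close> by simp
  \<comment> \<open>Otherwise \<open>h / k\<close> and \<open>h' / k'\<close> would be the same
    fraction in lowest terms.\<close>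
  moreover have "y \<noteq> 0"
  proof
    assume "y = 0"
    then have eq: "k * h' = h * k'" using y by simp
    then have "k dvd k'" "k' dvd k"
      using cop by (metis coprime_commute coprime_dvd_mult_right_iff dvd_triv_left mult.commute)+
    then have "k = k'" using kpos by (simp add: zdvd_antisym_nonneg)
    with eq kpos have "h = h'" by simp
    with \<open>k = k'\<close> z'(3) show False by (simp add: hk hk')
  qed
  ultimately show thesis using that[of x y] by simp
qed

text \<open>\<open>X + y * v * sqrt d\<close> is the power \<open>2 * t + 1\<close> of
  \<open>x + y * sqrt d\<close>. The step multiplies by the square
  \<open>1 + 2 * d * y^2 + 2 * x * y * sqrt d\<close>; modulo \<open>y^2\<close> this fixes
  \<open>X\<close> and adds \<open>2 * x^2\<close>, that is 2, to \<open>v\<close>. The congruence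
  for \<open>X\<close> keeps the induction going.\<close>

lemma pell_odd_multiple_nat:
  fixes d x y :: int
  assumes pell: "x\<^sup>2 = 1 + d * y\<^sup>2"
  shows "\<exists>X v. X\<^sup>2 = 1 + d * (y * v)\<^sup>2 \<and> y\<^sup>2 dvd X - x \<and> y\<^sup>2 dvd v - (2 * int t + 1)"
proof (induction t)
  case 0
  show ?case by (rule exI[of _ x], rule exI[of _ 1]) (simp add: pell)
next
  case (Suc t)
  then obtain X v p q where X: "X\<^sup>2 = 1 + d * (y * v)\<^sup>2"
    and p: "X - x = y\<^sup>2 * p" and q: "v - (2 * int t + 1) = y\<^sup>2 * q"
    by (auto elim!: dvdE)
  define X' where "X' = X * (1 + 2 * d * y\<^sup>2) + 2 * d * y\<^sup>2 * v * x"
  define v' where "v' = v * (1 + 2 * d * y\<^sup>2) + 2 * x * X"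
  have "X'\<^sup>2 - d * (y * v')\<^sup>2 = (X\<^sup>2 - d * (y * v)\<^sup>2) * ((1 + 2 * d * y\<^sup>2)\<^sup>2 - d * (2 * x * y)\<^sup>2)"
    unfolding X'_def v'_def by algebra
  also have "(1 + 2 * d * y\<^sup>2)\<^sup>2 - d * (2 * x * y)\<^sup>2 = 1"
    using pell by algebra
  finally have "X'\<^sup>2 = 1 + d * (y * v')\<^sup>2" using X by simp
  moreover have "X' - x = y\<^sup>2 * (p + 2 * d * X + 2 * d * v * x)"
    unfolding X'_def using p by algebra
  then have "y\<^sup>2 dvd X' - x" by simp
  moreover have "v' - (2 * int (Suc t) + 1) = y\<^sup>2 * (q + 2 * d * v + 2 * x * p + 2 * d)"
  proof -
    have "v' - (2 * int (Suc t) + 1) = (v - (2 * int t + 1)) + 2 * d * y\<^sup>2 * v + 2 * x * (X - x) + 2 * (x\<^sup>2 - 1)"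
      unfolding v'_def by (simp add: algebra_simps power2_eq_square)
    also have "\<dots> = y\<^sup>2 * (q + 2 * d * v + 2 * x * p + 2 * d)"
      unfolding p q using pell by (simp add: algebra_simps)
    finally show ?thesis .
  qed
  then have "y\<^sup>2 dvd v' - (2 * int (Suc t) + 1)" by simp
  ultimately show ?case by blast
qed

lemma pell_odd_multiple:
  fixes d x y m :: int
  assumes pell: "x\<^sup>2 = 1 + d * y\<^sup>2" and "y \<noteq> 0" "odd m"
  obtains X v where "X\<^sup>2 = 1 + d * (y * v)\<^sup>2" "y\<^sup>2 dvd v - m"
proof -
  obtain c where c: "m = 2 * c + 1" using \<open>odd m\<close> by (rule oddE)
  \<comment> \<open>The added multiple of \<open>y^2\<close> makes the index nonnegative without
    changing its class modulo \<open>y^2\<close>.\<close>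
  define t where "t = nat (c + y\<^sup>2 * \<bar>c\<bar>)"
  have "y\<^sup>2 \<ge> 1" using \<open>y \<noteq> 0\<close> by (simp add: int_one_le_iff_zero_less)
  then have "1 * \<bar>c\<bar> \<le> y\<^sup>2 * \<bar>c\<bar>" by (intro mult_right_mono) auto
  then have t: "int t = c + y\<^sup>2 * \<bar>c\<bar>" unfolding t_def by simp
  obtain X v where X: "X\<^sup>2 = 1 + d * (y * v)\<^sup>2" and v: "y\<^sup>2 dvd v - (2 * int t + 1)"
    using pell_odd_multiple_nat[OF pell] by blast
  have "v - m = (v - (2 * int t + 1)) + y\<^sup>2 * (2 * \<bar>c\<bar>)"
    unfolding t c by (simp add: algebra_simps)
  then have "y\<^sup>2 dvd v - m" using v by (metis dvd_add dvd_triv_left)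
  with X show thesis by (rule that)
qed

text \<open>
  Modulo a power of 2 the second factor can be made to vanish, modulo an odd number the
  first one.
\<close>

lemma dvd_product_of_progressions:
  fixes P :: int
  assumes "P \<noteq> 0"
  obtains r where "P dvd (2 * r - 1) * (3 * r - 1)"
proof -
  obtain e o' where P: "P = 2 ^ e * o'" and "odd o'"
  proof (rule that)
    show "P = 2 ^ multiplicity 2 P * (P div 2 ^ multiplicity 2 P)"
      by (simp add: multiplicity_dvd)
    show "odd (P div 2 ^ multiplicity 2 P)"
      using multiplicity_decompose[of P 2] assms by simp
  qed
  have cop: "coprime (2 ^ e) o'" using \<open>odd o'\<close> by simp
  have "coprime 3 (2 ^ e :: int)" by simp
  then obtain a :: int where a: "[3 * a = 1] (mod 2 ^ e)" using cong_solve_coprime_int by blast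
  have "coprime 2 o'" using \<open>odd o'\<close> by simp
  then obtain b :: int where b: "[2 * b = 1] (mod o')" using cong_solve_coprime_int by blast
  obtain r where r: "[r = a] (mod 2 ^ e)" "[r = b] (mod o')"
    using binary_chinese_remainder_int[OF cop] by blast
  have "[3 * r = 1] (mod 2 ^ e)" using cong_trans[OF cong_scalar_left[OF r(1)] a] .
  then have "2 ^ e dvd 3 * r - 1" by (simp add: cong_iff_dvd_diff)
  moreover have "[2 * r = 1] (mod o')" using cong_trans[OF cong_scalar_left[OF r(2)] b] .
  then have "o' dvd 2 * r - 1" by (simp add: cong_iff_dvd_diff)
  ultimately have "P dvd (2 * r - 1) * (3 * r - 1)"
    unfolding P by (metis mult.commute mult_dvd_mono)
  then show thesis by (rule that)
qed


section \<open>The polynomial\<close>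

text \<open>The step is \<open>y\<^sub>k \<mapsto> y\<^sub>3\<^sub>k\<close> for the solutions of \<open>x\<^sub>k\<^sup>2 - d y\<^sub>k\<^sup>2 = 1\<close>.\<close>

primrec chain :: "int \<Rightarrow> 'r::comm_ring_1 \<Rightarrow> nat \<Rightarrow> 'r" where
  "chain d u 0 = u"
| "chain d u (Suc i) = 3 * chain d u i + 4 * (of_int d * chain d u i ^ 3)"

text \<open>The \<open>a i\<close> act as digits to the bases \<open>chain d u i\<close>. The
  summand 1 and the factor 2 make the value odd at rational integers, as
  \<open>pell_odd_multiple\<close> demands.\<close>

definition digits :: "int \<Rightarrow> 'r::comm_ring_1 \<Rightarrow> (nat \<Rightarrow> 'r) \<Rightarrow> nat \<Rightarrow> 'r" where
  "digits d u a n = 1 + (\<Sum>i<n. 2 * (a i * chain d u i))"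

text \<open>
  The factor 4 keeps \<open>u\<close> even, and makes it exceed the irrational parts of the \<open>a\<^sub>i\<close>.
\<close>

definition weight :: "(nat \<Rightarrow> 'r::comm_ring_1) \<Rightarrow> nat \<Rightarrow> 'r \<Rightarrow> 'r" where
  "weight a n R = 4 * (R * (\<Prod>i<n. 2 * a i ^ 2 + 1))"

text \<open>
  For \<open>\<theta> = P * j - T\<close> this is the product of \<open>\<theta> \<plusminus> P * \<surd>A1 \<plusminus> d * P * \<surd>A2\<close> over all choices of signs.
\<close>

definition combine :: "int \<Rightarrow> 'r::comm_ring_1 \<Rightarrow> 'r \<Rightarrow> 'r \<Rightarrow> 'r \<Rightarrow> 'r" where
  "combine d P \<theta> A1 A2 =
     \<theta> ^ 4 - 2 * (\<theta> ^ 2 * (P ^ 2 * (A1 + of_int (d ^ 2) * A2)))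
       + P ^ 4 * (A1 - of_int (d ^ 2) * A2) ^ 2"

text \<open>Polymorphic in the ring, so that it can be read as a polynomial, an integer or a field
  element. The unknown \<open>w\<close> scales the weight to \<open>u\<close>, \<open>r\<close> is
  the leading digit, and \<open>j\<close> merges the conditions.\<close>

definition defining_poly ::
    "int \<Rightarrow> nat \<Rightarrow> (nat \<Rightarrow> 'r::comm_ring_1) \<Rightarrow> 'r \<Rightarrow> 'r \<Rightarrow> 'r \<Rightarrow> 'r \<Rightarrow> 'r" where
  "defining_poly d n a R w r j =
     (let u = weight a n R * w; P = chain d u n; v = digits d u a n + P * r
      in combine d P (P * j - (2 * r - 1) * (3 * r - 1)) (1 + of_int d * u ^ 2)
           (1 + of_int d * (P * v) ^ 2))"

section \<open>Compatibility of the construction with ring homomorphisms\<close>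

locale ring_morphism =
  fixes h :: "'r::comm_ring_1 \<Rightarrow> 's::comm_ring_1"
  assumes add: "h (x + y) = h x + h y" and mult: "h (x * y) = h x * h y" and one: "h 1 = 1"
begin

lemma zero: "h 0 = 0"
  using add[of 0 0] by simp

lemma uminus: "h (- x) = - h x"
  using add[of x "- x"] zero by (simp add: eq_neg_iff_add_eq_0 add.commute)

lemma diff: "h (x - y) = h x - h y"
  using add[of x "- y"] uminus[of y] by simp

lemma power: "h (x ^ k) = h x ^ k"
  by (induction k) (simp_all add: one mult)

lemma of_nat: "h (of_nat k) = of_nat k"
  by (induction k) (simp_all add: zero one add)

lemma of_int: "h (of_int k) = of_int k"
  by (cases k rule: int_cases2) (simp_all add: of_nat uminus)

lemma numeral: "h (numeral k) = numeral k"
  using of_nat[of "numeral k"] by simp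

lemma sum: "h (sum f A) = (\<Sum>x\<in>A. h (f x))"
  by (induction A rule: infinite_finite_induct) (simp_all add: zero add)

lemma prod: "h (prod f A) = (\<Prod>x\<in>A. h (f x))"
  by (induction A rule: infinite_finite_induct) (simp_all add: one mult)

lemmas simps = add mult one diff power of_int numeral sum prod

lemma chain: "h (chain d u n) = chain d (h u) n"
  by (induction n) (simp_all add: simps)

lemma defining_poly:
  "h (defining_poly d n a R w r j) = defining_poly d n (\<lambda>i. h (a i)) (h R) (h w) (h r) (h j)"
  by (simp add: defining_poly_def Let_def combine_def digits_def weight_def simps chain del: of_int_power)

end

lemma ring_morphism_of_int: "ring_morphism (of_int :: int \<Rightarrow> 'r::comm_ring_1)"
  by standard auto

lemma digits_cong: "(\<And>i. i < n \<Longrightarrow> a i = b i) \<Longrightarrow> digits d u a n = digits d u b n"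
  by (simp add: digits_def)

lemma weight_cong: "(\<And>i. i < n \<Longrightarrow> a i = b i) \<Longrightarrow> weight a n R = weight b n R"
  by (simp add: weight_def)

lemma defining_poly_cong:
  assumes "\<And>i. i < n \<Longrightarrow> a i = b i"
  shows "defining_poly d n a R w r j = defining_poly d n b R w r j"
  using digits_cong[of n a b, OF assms] weight_cong[of n a b, OF assms] by (simp add: defining_poly_def)

lemma chain_0: "chain d 0 n = (0 :: 'r::comm_ring_1)"
  by (induction n) simp_all

text \<open>Each base is multiplied by \<open>3 + 4 * d * g^2\<close>, which exceeds
  \<open>1 + |g|\<close>. The bound \<open>|g| + g^2\<close> leaves room for one digit term of size
  \<open>g^2\<close> on top of a remainder below \<open>|g|\<close>.\<close>

lemma chain_growth:
  fixes d u :: int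
  assumes d: "d \<ge> 1" and u: "u \<noteq> 0"
  shows "\<bar>chain d u (Suc i)\<bar> \<ge> \<bar>chain d u i\<bar> + (chain d u i)\<^sup>2" "\<bar>chain d u i\<bar> \<ge> \<bar>u\<bar>" "chain d u i \<noteq> 0"
proof -
  have growth: "\<bar>3 * g + 4 * (d * g ^ 3)\<bar> \<ge> \<bar>g\<bar> + g\<^sup>2" if "g \<noteq> 0" for g :: int
  proof -
    have g1: "\<bar>g\<bar> \<ge> 1" using that by linarith
    have "\<bar>3 * g + 4 * (d * g ^ 3)\<bar> = \<bar>g * (3 + 4 * d * g\<^sup>2)\<bar>"
      by (simp add: algebra_simps power2_eq_square power3_eq_cube)
    also have "\<dots> = \<bar>g\<bar> * (3 + 4 * d * g\<^sup>2)" using d by (simp add: abs_mult)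
    finally have eq: "\<bar>3 * g + 4 * (d * g ^ 3)\<bar> = \<bar>g\<bar> * (3 + 4 * d * g\<^sup>2)" .
    have "\<bar>g\<bar> * 1 \<le> \<bar>g\<bar> * \<bar>g\<bar>" using g1 by (intro mult_left_mono) auto
    then have "\<bar>g\<bar> \<le> g\<^sup>2" by (simp add: power2_eq_square)
    moreover have "1 * g\<^sup>2 \<le> d * g\<^sup>2" using d by (intro mult_right_mono) auto
    ultimately have "1 + \<bar>g\<bar> \<le> 3 + 4 * d * g\<^sup>2" by linarith
    then have "\<bar>g\<bar> * (1 + \<bar>g\<bar>) \<le> \<bar>g\<bar> * (3 + 4 * d * g\<^sup>2)" by (intro mult_left_mono) auto
    then show ?thesis unfolding eq by (simp add: algebra_simps power2_eq_square)
  qed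
  have ge: "\<bar>chain d u i\<bar> \<ge> \<bar>u\<bar>" for i
  proof (induction i)
    case (Suc i)
    then have "chain d u i \<noteq> 0" using u by auto
    from growth[OF this] Suc have "\<bar>u\<bar> \<le> \<bar>3 * chain d u i + 4 * (d * chain d u i ^ 3)\<bar>"
      using zero_le_power2[of "chain d u i"] by linarith
    then show ?case by simp
  qed simp
  show ne: "chain d u i \<noteq> 0" and "\<bar>chain d u i\<bar> \<ge> \<bar>u\<bar>" using ge[of i] u by auto
  show "\<bar>chain d u (Suc i)\<bar> \<ge> \<bar>chain d u i\<bar> + (chain d u i)\<^sup>2" using growth[OF ne] by simp
qed

text \<open>\<open>X * (1 + 4 * d * g^2)\<close> and the next chain element are the coordinates of
  the cube of \<open>X + g * sqrt d\<close>.\<close>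

lemma chain_pell:
  fixes d u x :: int
  assumes "x\<^sup>2 = 1 + d * u\<^sup>2"
  shows "\<exists>X. X\<^sup>2 = 1 + d * (chain d u i)\<^sup>2"
proof (induction i)
  case (Suc i)
  then obtain X where X: "X\<^sup>2 = 1 + d * (chain d u i)\<^sup>2" by auto
  define g where "g = chain d u i"
  have "(X * (1 + 4 * d * g\<^sup>2))\<^sup>2 = (1 + d * g\<^sup>2) * (1 + 4 * d * g\<^sup>2)\<^sup>2"
    using X by (simp add: power_mult_distrib g_def)
  also have "\<dots> = 1 + d * (3 * g + 4 * (d * g ^ 3))\<^sup>2" by algebra
  finally show ?case by (auto simp: g_def)
qed (use assms in auto)

lemma chain_even: "even u \<Longrightarrow> even (chain d u i :: int)"
  by (induction i) auto

text \<open>Uniqueness of mixed radix digits: the lower part is smaller than the top base, so the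
  top digit vanishes, and the next digit takes its place.\<close>

lemma chain_digits_eq_0:
  fixes d u \<rho> :: int
  assumes d: "d \<ge> 1" and u: "u \<noteq> 0" and b: "\<And>i. i < k \<Longrightarrow> 2 * \<bar>b i\<bar> \<le> \<bar>u\<bar>"
    and eq: "(\<Sum>i<k. 2 * (b i * chain d u i)) + chain d u k * \<rho> = 0"
  shows "\<rho> = 0 \<and> (\<forall>i<k. b i = 0)"
  using b eq
proof (induction k arbitrary: \<rho>)
  case 0
  then show ?case using u by simp
next
  case (Suc k)
  \<comment> \<open>A digit term at base \<open>g\<close> is at most
    \<open>|u| * |g| \<le> g^2\<close>, while the next base is at least
    \<open>|g| + g^2\<close>.\<close>
  have bound: "\<bar>\<Sum>i<m. 2 * (b i * chain d u i)\<bar> < \<bar>chain d u m\<bar>" if "m \<le> Suc k" for m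
    using that
  proof (induction m)
    case 0
    then show ?case using u by simp
  next
    case (Suc m)
    let ?g = "chain d u m"
    have "\<bar>2 * (b m * ?g)\<bar> = (2 * \<bar>b m\<bar>) * \<bar>?g\<bar>" by (simp add: abs_mult)
    also have "\<dots> \<le> \<bar>?g\<bar> * \<bar>?g\<bar>"
      using Suc.prems Suc.prems(1) \<open>\<And>i. i < Suc k \<Longrightarrow> 2 * \<bar>b i\<bar> \<le> \<bar>u\<bar>\<close>[of m] chain_growth(2)[OF d u, of m]
      by (intro mult_right_mono) auto
    also have "\<dots> = ?g\<^sup>2" by (simp add: power2_eq_square)
    finally show ?case
      using Suc chain_growth(1)[OF d u, of m] by (simp del: chain.simps)
  qed
  have *: "\<rho> = 0"
  proof (rule ccontr)
    assume "\<rho> \<noteq> 0"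
    then have "\<bar>chain d u (Suc k)\<bar> * 1 \<le> \<bar>chain d u (Suc k)\<bar> * \<bar>\<rho>\<bar>"
      by (intro mult_left_mono) auto
    also have "\<dots> = \<bar>chain d u (Suc k) * \<rho>\<bar>" by (simp only: abs_mult)
    also have "\<dots> = \<bar>\<Sum>i<Suc k. 2 * (b i * chain d u i)\<bar>"
      using Suc.prems(2) by linarith
    also have "\<dots> < \<bar>chain d u (Suc k)\<bar>" by (rule bound) simp
    finally show False by simp
  qed
  \<comment> \<open>With \<rho> gone, \<open>2 * b k\<close> is the new top digit.\<close>
  then have "(\<Sum>i<k. 2 * (b i * chain d u i)) + chain d u k * (2 * b k) = 0"
    using Suc.prems(2) by (simp add: algebra_simps)
  from Suc.IH[OF _ this] Suc.prems(1) have "2 * b k = 0 \<and> (\<forall>i<k. b i = 0)" by simp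
  with * show ?case by (auto simp: less_Suc_eq)
qed

text \<open>Of the four factors of \<open>combine\<close>, the one with both signs negative
  vanishes.\<close>

lemma combine_factor:
  fixes x y \<theta> :: int
  assumes "\<theta> = P * (x + d * y)"
  shows "combine d P \<theta> (x\<^sup>2) (y\<^sup>2) = 0"
  unfolding combine_def assms of_int_eq_id id_apply by algebra

text \<open>Divided by \<open>P ^ 4\<close> and with \<open>e = d^2 * A2\<close>, the equation reads
  \<open>(z^2 + A1 - e)^2 = (2 * z)^2 * A1\<close>, and equally with \<open>A1\<close> and
  \<open>e\<close> exchanged. So \<open>z\<close> alone expresses both roots rationally;
  \<open>ne\<close> guarantees that \<open>z\<close> is not 0.\<close>

lemma combine_imp_squares:
  fixes \<theta> :: "'f::field_char_0"
  assumes eq: "combine d P \<theta> A1 A2 = 0" and P: "P \<noteq> 0" and d: "d \<noteq> 0"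
    and ne: "A1 \<noteq> of_int (d\<^sup>2) * A2"
  defines "z \<equiv> \<theta> / P"
  shows "((z\<^sup>2 + A1 - of_int (d\<^sup>2) * A2) / (2 * z))\<^sup>2 = A1"
    and "((z\<^sup>2 - A1 + of_int (d\<^sup>2) * A2) / (2 * of_int d * z))\<^sup>2 = A2"
proof -
  define e :: 'f where "e = of_int (d\<^sup>2) * A2"
  have \<theta>: "\<theta> = z * P" using P by (simp add: z_def)
  have "P ^ 4 * (z ^ 4 - 2 * z\<^sup>2 * (A1 + e) + (A1 - e)\<^sup>2) = combine d P \<theta> A1 A2"
    unfolding combine_def \<theta> e_def[symmetric] by algebra
  then have Q: "z ^ 4 - 2 * z\<^sup>2 * (A1 + e) + (A1 - e)\<^sup>2 = 0" using eq P by simp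
  then have z: "z \<noteq> 0" using ne by (auto simp: e_def)
  have "(z\<^sup>2 + A1 - e)\<^sup>2 = (2 * z)\<^sup>2 * A1" using Q by algebra
  then show "((z\<^sup>2 + A1 - of_int (d\<^sup>2) * A2) / (2 * z))\<^sup>2 = A1"
    using z by (simp add: e_def power_divide)
  have "(z\<^sup>2 - A1 + e)\<^sup>2 = (2 * z)\<^sup>2 * e" using Q by algebra
  also have "\<dots> = (2 * of_int d * z)\<^sup>2 * A2" by (simp add: e_def power_mult_distrib)
  finally show "((z\<^sup>2 - A1 + of_int (d\<^sup>2) * A2) / (2 * of_int d * z))\<^sup>2 = A2"
    using z d by (simp add: e_def power_divide)
qed

section \<open>Solvability for rational integers\<close>

lemma defining_poly_int_zero:
  fixes a :: "nat \<Rightarrow> int" and d R :: int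
  assumes d: "d > 0" "\<And>k. k\<^sup>2 \<noteq> d" and R: "R \<noteq> 0"
  obtains w r j :: int where "defining_poly d n a R w r j = 0"
proof -
  define W where "W = weight a n R"
  have "2 * a i ^ 2 + 1 \<noteq> 0" for i by presburger
  then have W: "W \<noteq> 0" using R by (simp add: W_def weight_def)
  have "even W" by (simp add: W_def weight_def)
  \<comment> \<open>Hence the Pell equation for \<open>d * W^2\<close> has a nontrivial solution,
    which gives a \<open>u\<close> divisible by \<open>W\<close>.\<close>
  have "k\<^sup>2 \<noteq> d * W\<^sup>2" for k
  proof
    assume k: "k\<^sup>2 = d * W\<^sup>2"
    then have "W\<^sup>2 dvd k\<^sup>2" by simp
    then have "W dvd k" by simp
    then obtain l where "k = W * l" by (rule dvdE)
    with k W have "l\<^sup>2 = d" by (simp add: power_mult_distrib)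
    with d(2) show False by blast
  qed
  then obtain x w where xw: "x\<^sup>2 = 1 + d * W\<^sup>2 * w\<^sup>2" "w \<noteq> 0"
    using int_pell_exists[of "d * W\<^sup>2"] d(1) W by auto
  define u where "u = W * w"
  have x: "x\<^sup>2 = 1 + d * u\<^sup>2" using xw(1) by (simp add: u_def power_mult_distrib mult.assoc)
  have u: "u \<noteq> 0" "even u" using W xw(2) \<open>even W\<close> by (auto simp: u_def)
  define P where "P = chain d u n"
  have P: "P \<noteq> 0" "even P" using u d(1) by (auto simp: P_def chain_growth chain_even)
  define A where "A = digits d u a n"
  have "odd A" by (simp add: A_def digits_def sum_distrib_left[symmetric])
  obtain r0 where r0: "P dvd (2 * r0 - 1) * (3 * r0 - 1)"
    using dvd_product_of_progressions[OF P(1)] .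
  obtain y where y: "y\<^sup>2 = 1 + d * P\<^sup>2" using chain_pell[OF x] unfolding P_def by blast
  \<comment> \<open>This odd class is reached modulo \<open>P^2\<close> and not only modulo
    \<open>P\<close>; therefore \<open>r\<close> below can agree with \<open>r0\<close> modulo
    \<open>P\<close> and keep the divisibility.\<close>
  have "odd (A + P * r0)" using \<open>odd A\<close> P(2) by simp
  from pell_odd_multiple[OF y P(1) this] obtain X v
    where X: "X\<^sup>2 = 1 + d * (P * v)\<^sup>2" and v: "P\<^sup>2 dvd v - (A + P * r0)" .
  obtain t where t: "v - (A + P * r0) = P\<^sup>2 * t" using v by (rule dvdE)
  define r where "r = r0 + P * t"
  have v_eq: "v = A + P * r" using t by (simp add: r_def algebra_simps power2_eq_square)
  have "(2 * r - 1) * (3 * r - 1) = (2 * r0 - 1) * (3 * r0 - 1) + P * (t * (2 * (3 * r0 - 1) + 3 * (2 * r0 - 1) + 6 * P * t))"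
    unfolding r_def by algebra
  then have "P dvd (2 * r - 1) * (3 * r - 1)" using r0 by (metis dvd_add dvd_triv_left)
  then obtain q where q: "(2 * r - 1) * (3 * r - 1) = P * q" by (rule dvdE)
  \<comment> \<open>With this value, \<open>P * j - (2 * r - 1) * (3 * r - 1)\<close> equals
    \<open>P * (x + d * X)\<close>, as \<open>combine_factor\<close> requires.\<close>
  define j where "j = q + x + d * X"
  have "defining_poly d n a R w r j = combine d P (P * j - (2 * r - 1) * (3 * r - 1)) (x\<^sup>2) (X\<^sup>2)"
    unfolding defining_poly_def Let_def W_def[symmetric] u_def[symmetric] P_def[symmetric]
      A_def[symmetric] v_eq[symmetric] x X by simp
  also have "\<dots> = 0"
    by (rule combine_factor) (unfold q j_def of_int_eq_id id_apply, simp only: algebra_simps)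
  finally show thesis by (rule that)
qed


section \<open>Zeros over the ring of integers\<close>

context quadratic
begin

lemma d_nonsquare: "k\<^sup>2 \<noteq> d"
proof
  assume k: "k\<^sup>2 = d"
  show False
  proof (cases "D > 0")
    case True
    then have "k\<^sup>2 dvd D" using k unfolding d_def by simp
    then have "k dvd 1" by (rule squarefreeD[OF sqfree])
    then have "k\<^sup>2 = 1" by (metis power2_abs one_power2 zdvd1_eq)
    with k d_ge_2 show False by linarith
  next
    case False
    then have k3: "k\<^sup>2 = 3" using k unfolding d_def by simp
    have "\<bar>k\<bar> \<le> 1 \<or> \<bar>k\<bar> \<ge> 2" by linarith
    moreover have "k\<^sup>2 \<le> 1\<^sup>2" if "\<bar>k\<bar> \<le> 1" using that abs_le_square_iff[of k 1] by simp
    moreover have "k\<^sup>2 \<ge> 2\<^sup>2" if "\<bar>k\<bar> \<ge> 2" using that abs_le_square_iff[of 2 k] by simp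
    ultimately show False using k3 by auto
  qed
qed

lemma chain_OK: "u \<in> OK \<Longrightarrow> chain d u n \<in> OK"
  by (induction n) (simp_all add: OK_add OK_mult OK_power)

lemma digits_OK: "u \<in> OK \<Longrightarrow> (\<And>i. i < n \<Longrightarrow> a i \<in> OK) \<Longrightarrow> digits d u a n \<in> OK"
  unfolding digits_def by (intro OK_add OK_sum OK_mult chain_OK) auto

lemma of_int_multiple_in_Ints:
  assumes "v \<in> OK" "of_int m * v \<in> \<int>" "m \<noteq> 0"
  shows "v \<in> \<int>"
proof -
  obtain k where k: "of_int m * v = of_int k" using assms(2) by (rule Ints_cases)
  have "v = of_int k / of_int m" using k assms(3) by (simp add: field_simps)
  then have "v \<in> \<rat>" by simp
  then show ?thesis using assms(1) by (intro OK_Rats)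
qed

lemma cj_sum: "(\<And>i. i \<in> A \<Longrightarrow> f i \<in> K) \<Longrightarrow> cj (sum f A) = (\<Sum>i\<in>A. cj (f i)) \<and> sum f A \<in> K"
proof (induction A rule: infinite_finite_induct)
  case (insert x F)
  then show ?case by (simp add: cj_add K_add)
qed (use cj_of_int[of 0] K_of_int[of 0] in auto)

theorem defining_poly_zero_iff:
  assumes a: "\<And>i. i < n \<Longrightarrow> a i \<in> OK" and R: "R \<in> OK"
    and RZ: "(\<forall>i<n. a i \<in> \<int>) \<Longrightarrow> R \<in> \<int>"
  shows "(\<exists>w\<in>OK. \<exists>r\<in>OK. \<exists>j\<in>OK. defining_poly d n a R w r j = 0) \<longleftrightarrow> (\<forall>i<n. a i \<in> \<int>) \<and> R \<noteq> 0"
proof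
  assume "(\<forall>i<n. a i \<in> \<int>) \<and> R \<noteq> 0"
  then have "\<exists>m. a i = of_int m" if "i < n" for i
    using that by (auto elim!: Ints_cases)
  then obtain b where b: "\<And>i. i < n \<Longrightarrow> a i = of_int (b i)" by metis
  obtain \<rho> where \<rho>: "R = of_int \<rho>"
    using RZ \<open>(\<forall>i<n. a i \<in> \<int>) \<and> R \<noteq> 0\<close> by (auto elim: Ints_cases)
  obtain w r j :: int where "defining_poly d n b \<rho> w r j = 0"
    by (rule defining_poly_int_zero[of d \<rho> n b])
      (use d_ge_2 d_nonsquare \<rho> \<open>(\<forall>i<n. a i \<in> \<int>) \<and> R \<noteq> 0\<close> in auto)
  then have "defining_poly d n (\<lambda>i. of_int (b i)) (of_int \<rho>) (of_int w) (of_int r) (of_int j) = (0 :: 'a)"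
    using ring_morphism.defining_poly[OF ring_morphism_of_int[where 'r = 'a], of d n b \<rho> w r j] by simp
  then have "defining_poly d n a R (of_int w) (of_int r) (of_int j) = 0"
    using defining_poly_cong[of n a "\<lambda>i. of_int (b i)", OF b] by (simp add: \<rho>)
  then show "\<exists>w\<in>OK. \<exists>r\<in>OK. \<exists>j\<in>OK. defining_poly d n a R w r j = 0"
    using OK_of_int by blast
next
  assume "\<exists>w\<in>OK. \<exists>r\<in>OK. \<exists>j\<in>OK. defining_poly d n a R w r j = 0"
  then obtain w r j where OKs: "w \<in> OK" "r \<in> OK" "j \<in> OK" and zero: "defining_poly d n a R w r j = 0"
    by blast
  define u where "u = weight a n R * w"
  define P where "P = chain d u n"
  define v where "v = digits d u a n + P * r"
  define T where "T = (2 * r - 1) * (3 * r - 1)"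
  define A1 where "A1 = 1 + of_int d * u\<^sup>2"
  define A2 where "A2 = 1 + of_int d * (P * v)\<^sup>2"
  have comb: "combine d P (P * j - T) A1 A2 = 0"
    using zero by (simp only: defining_poly_def Let_def u_def P_def v_def T_def A1_def A2_def)
  have u: "u \<in> OK"
    unfolding u_def weight_def using a R OKs
    by (intro OK_mult OK_prod OK_add OK_power) auto
  have P: "P \<in> OK" unfolding P_def using u by (rule chain_OK)
  have v: "v \<in> OK" unfolding v_def using u P OKs a by (intro OK_add OK_mult digits_OK) auto
  have T: "T \<in> OK" unfolding T_def using OKs by (intro OK_mult OK_diff) auto
  have A: "A1 \<in> OK" "A2 \<in> OK"
    unfolding A1_def A2_def using u P v by (auto intro!: OK_add OK_mult OK_power)
  \<comment> \<open>\<open>T = 0\<close> would make 2 or 3 a unit, and for \<open>P = 0\<close> the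
    equation would collapse to \<open>T ^ 4 = 0\<close>. That \<open>P\<close> is nonzero passes
    back to \<open>u\<close> and then to \<open>R\<close>.\<close>
  have "2 * r - 1 \<noteq> 0" using not_OK_inverse[OF OKs(2), of 2] by auto
  moreover have "3 * r - 1 \<noteq> 0" using not_OK_inverse[OF OKs(2), of 3] by auto
  ultimately have "T \<noteq> 0" by (simp add: T_def)
  then have P0: "P \<noteq> 0" using comb by (auto simp: combine_def)
  then have u0: "u \<noteq> 0" by (auto simp: P_def chain_0)
  then have R0: "R \<noteq> 0" by (auto simp: u_def weight_def)
  \<comment> \<open>Equality would make \<open>d\<close> a unit.\<close>
  have ne: "A1 \<noteq> of_int (d\<^sup>2) * A2"
  proof
    assume "A1 = of_int (d\<^sup>2) * A2"
    then have "of_int d * (of_int d * A2 - u\<^sup>2) = 1"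
      by (simp add: A1_def power2_eq_square algebra_simps)
    moreover have "of_int d * A2 - u\<^sup>2 \<in> OK"
      using A u by (intro OK_diff OK_mult OK_power) auto
    ultimately have "\<bar>d\<bar> = 1" using not_OK_inverse by blast
    then show False using d_ge_2 by simp
  qed
  have d0: "d \<noteq> 0" using d_ge_2 by simp
  define z where "z = (P * j - T) / P"
  have z: "z \<in> K" unfolding z_def
    using P T OKs by (intro K_divide OK_subset_K OK_diff OK_mult)
  have K_num: "2 \<in> K" using OK_subset_K[OF OK_numeral(1)] .
  have z2: "z\<^sup>2 \<in> K" using cj_power[OF z, of 2] by simp
  have A_K: "A1 \<in> K" "A2 \<in> K" using A by (auto dest: OK_subset_K)
  \<comment> \<open>Both roots lie in \<open>K\<close> as rational expressions in \<open>z\<close>;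
    \<open>OK_sqrt\<close> then makes them integral, so that \<open>pell_solution_in_Ints\<close>
    applies.\<close>
  obtain \<alpha> where \<alpha>: "\<alpha> \<in> K" "\<alpha>\<^sup>2 = A1"
  proof (rule that)
    show "(z\<^sup>2 + A1 - of_int (d\<^sup>2) * A2) / (2 * z) \<in> K"
      using z z2 A_K K_num by (intro K_divide K_add K_diff K_mult K_of_int)
  qed (unfold z_def, rule combine_imp_squares(1)[OF comb P0 d0 ne])
  obtain \<beta> where \<beta>: "\<beta> \<in> K" "\<beta>\<^sup>2 = A2"
  proof (rule that)
    show "(z\<^sup>2 - A1 + of_int (d\<^sup>2) * A2) / (2 * of_int d * z) \<in> K"
      using z z2 A_K K_num by (intro K_divide K_add K_diff K_mult K_of_int)
  qed (unfold z_def, rule combine_imp_squares(2)[OF comb P0 d0 ne])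
  have "u \<in> \<int>"
    using pell_solution_in_Ints(2)[of \<alpha> u] OK_sqrt[OF \<alpha>(1)] \<alpha>(2) A(1) u by (auto simp: A1_def)
  then obtain U where U: "u = of_int U" by (rule Ints_cases)
  define g where "g = (\<lambda>i. chain d U i)"
  have g: "chain d u i = of_int (g i)" for i
    unfolding g_def U using ring_morphism.chain[OF ring_morphism_of_int[where 'r = 'a], of d U i] by simp
  have U0: "U \<noteq> 0" using u0 U by simp
  have "P * v \<in> \<int>"
    using pell_solution_in_Ints(2)[of \<beta> "P * v"] OK_sqrt[OF \<beta>(1)] \<beta>(2) A(2) OK_mult[OF P v]
    by (auto simp: A2_def)
  then have "of_int (g n) * v \<in> \<int>" using g[of n] by (simp add: P_def)
  moreover have "g n \<noteq> 0" using P0 g[of n] by (simp add: P_def)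
  ultimately have "v \<in> \<int>" by (rule of_int_multiple_in_Ints[OF v])
  then obtain V where V: "v = of_int V" by (rule Ints_cases)
  have "\<exists>b. a i - cj (a i) = of_int b * s" if "i < n" for i
    using imag_obtains[OF a[OF that]] by blast
  then obtain b where b: "\<And>i. i < n \<Longrightarrow> a i - cj (a i) = of_int (b i) * s" by metis
  obtain \<rho> where \<rho>: "r - cj r = of_int \<rho> * s" using imag_obtains[OF OKs(2)] .
  have bound: "2 * \<bar>b i\<bar> \<le> \<bar>U\<bar>" if i: "i < n" for i
  proof -
    \<comment> \<open>The cofactor of \<open>4 * (2 * (a i)^2 + 1)\<close> in \<open>u\<close>.
      Taking norms gives \<open>U^2 = 16 * (m * k)\<close> with \<open>k\<close> positive, and
      \<open>imag_bound\<close> gives \<open>4 * (b i)^2 \<le> 16 * m\<close>.\<close>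
    define y where "y = R * (\<Prod>k\<in>{..<n} - {i}. 2 * (a k)\<^sup>2 + 1) * w"
    have y: "y \<in> OK" unfolding y_def using R OKs a
      by (intro OK_mult OK_prod OK_add OK_power) auto
    have ai: "2 * (a i)\<^sup>2 + 1 \<in> OK" using a[OF i] by (intro OK_mult OK_add OK_power) auto
    have "(\<Prod>k<n. 2 * (a k)\<^sup>2 + 1) = (2 * (a i)\<^sup>2 + 1) * (\<Prod>k\<in>{..<n} - {i}. 2 * (a k)\<^sup>2 + 1)"
      using i by (intro prod.remove) auto
    then have uy: "u = of_int 4 * ((2 * (a i)\<^sup>2 + 1) * y)"
      by (simp add: u_def weight_def y_def mult_ac)
    obtain m where m: "(2 * (a i)\<^sup>2 + 1) * cj (2 * (a i)\<^sup>2 + 1) = of_int m" using norm_obtains[OF ai] .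
    obtain k where k: "y * cj y = of_int k" using norm_obtains[OF y] .
    note mb = imag_bound[OF a[OF i] b[OF i] m]
    have "of_int (U\<^sup>2) = u * cj u" by (simp add: U power2_eq_square)
    also have "cj u = of_int 4 * (cj (2 * (a i)\<^sup>2 + 1) * cj y)"
      unfolding uy using OK_subset_K[OF ai] OK_subset_K[OF y] by (simp only: cj_mult K_mult K_of_int cj_of_int)
    also have "u * \<dots> = of_int 16 * (((2 * (a i)\<^sup>2 + 1) * cj (2 * (a i)\<^sup>2 + 1)) * (y * cj y))"
      unfolding uy by (simp add: mult_ac)
    also have "\<dots> = of_int (16 * (m * k))" unfolding m k by simp
    finally have Umk: "U\<^sup>2 = 16 * (m * k)" by (simp only: of_int_eq_iff)
    have "U\<^sup>2 > 0" using U0 by simp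
    then have "m * k > 0" using Umk by linarith
    then have "k > 0" using mb(2) by (simp add: zero_less_mult_iff)
    then have "m * 1 \<le> m * k" using mb(2) by (intro mult_left_mono) auto
    then have "4 * (b i)\<^sup>2 \<le> U\<^sup>2" using Umk mb by linarith
    then have "(2 * b i)\<^sup>2 \<le> U\<^sup>2" by (simp add: power_mult_distrib)
    then show ?thesis using abs_le_square_iff[of "2 * b i" U] by (simp add: abs_mult)
  qed
  \<comment> \<open>As \<open>v\<close> is a rational integer, \<open>v - cj v = 0\<close>; the
    coefficient of \<open>s\<close> in this difference is the digit sum formed from the irrational
    parts.\<close>
  have digits_zero: "(\<Sum>i<n. 2 * (b i * chain d U i)) + chain d U n * \<rho> = 0"
  proof -
    have aK: "a i \<in> K" if "i < n" for i using a[OF that] by (rule OK_subset_K)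
    have v_eq: "v = 1 + (\<Sum>i<n. of_int (2 * g i) * a i) + of_int (g n) * r"
      unfolding v_def digits_def P_def g by (simp add: mult_ac)
    have cjv_eq: "cj v = 1 + (\<Sum>i<n. of_int (2 * g i) * cj (a i)) + of_int (g n) * cj r"
    proof -
      have s: "cj (\<Sum>i<n. of_int (2 * g i) * a i) = (\<Sum>i<n. of_int (2 * g i) * cj (a i))"
        "(\<Sum>i<n. of_int (2 * g i) * a i) \<in> K"
      proof -
        have "of_int (2 * g i) * a i \<in> K" if "i \<in> {..<n}" for i
          using that by (intro K_mult K_of_int aK) simp
        then have "cj (\<Sum>i<n. of_int (2 * g i) * a i) = (\<Sum>i<n. cj (of_int (2 * g i) * a i)) \<and>
            (\<Sum>i<n. of_int (2 * g i) * a i) \<in> K"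
          by (rule cj_sum)
        then
        have 1: "cj (\<Sum>i<n. of_int (2 * g i) * a i) = (\<Sum>i<n. cj (of_int (2 * g i) * a i))"
          and 2: "(\<Sum>i<n. of_int (2 * g i) * a i) \<in> K" by blast+
        have "(\<Sum>i<n. cj (of_int (2 * g i) * a i)) = (\<Sum>i<n. of_int (2 * g i) * cj (a i))"
          by (intro sum.cong refl) (simp only: lessThan_iff aK cj_mult K_of_int cj_of_int)
        with 1 2 show "cj (\<Sum>i<n. of_int (2 * g i) * a i) = (\<Sum>i<n. of_int (2 * g i) * cj (a i))"
          "(\<Sum>i<n. of_int (2 * g i) * a i) \<in> K" by simp_all
      qed
      have "cj (of_int 1 + (\<Sum>i<n. of_int (2 * g i) * a i) + of_int (g n) * r)
          = of_int 1 + (\<Sum>i<n. of_int (2 * g i) * cj (a i)) + of_int (g n) * cj r"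
        using OK_subset_K[OF OKs(2)] by (simp only: cj_add cj_mult K_add K_mult K_of_int cj_of_int s)
      with v_eq show ?thesis by (simp only: of_int_1)
    qed
    have "0 = v - cj v" by (simp add: V)
    also have "\<dots> = (1 + (\<Sum>i<n. of_int (2 * g i) * a i) + of_int (g n) * r)
        - (1 + (\<Sum>i<n. of_int (2 * g i) * cj (a i)) + of_int (g n) * cj r)"
      by (simp only: v_eq[symmetric] cjv_eq[symmetric])
    also have "\<dots> = (\<Sum>i<n. of_int (2 * g i) * (a i - cj (a i))) + of_int (g n) * (r - cj r)"
      by (simp add: sum_subtractf right_diff_distrib del: of_int_mult)
    also have "\<dots> = (\<Sum>i<n. of_int (2 * g i) * (of_int (b i) * s)) + of_int (g n) * (of_int \<rho> * s)"
      using b \<rho> by simp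
    also have "\<dots> = of_int ((\<Sum>i<n. 2 * (b i * g i)) + g n * \<rho>) * s"
      by (simp add: distrib_left sum_distrib_left mult_ac)
    finally show ?thesis using of_int_mult_s_eq_0_iff unfolding g_def by metis
  qed
  have "d \<ge> 1" using d_ge_2 by simp
  from chain_digits_eq_0[OF this U0 bound digits_zero] have b0: "\<forall>i<n. b i = 0" by blast
  have "a i \<in> \<int>" if "i < n" for i
    using b[OF that] b0 that by (intro Ints_if_imag_eq_0 a) auto
  with R0 show "(\<forall>i<n. a i \<in> \<int>) \<and> R \<noteq> 0" by blast
qed

end


section \<open>Quadratic fields are generated by square roots\<close>

interpretation rat_vs: vector_space "\<lambda>(q::rat) (x::'a::field_char_0). of_rat q * x"
  by unfold_locales (simp_all add: of_rat_add of_rat_mult algebra_simps)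

text \<open>Two rational basis elements would be dependent, so some basis element \<open>e\<close>
  is irrational. The independent pair \<open>e, 1\<close> spans \<open>K\<close>, since a third
  independent element would exceed the dimension.\<close>

lemma quadratic_field_span:
  fixes K :: "'a::field_char_0 set"
  assumes "quadratic_field K"
  obtains e where "e \<in> K" "e \<notin> \<rat>" "\<And>z. z \<in> K \<Longrightarrow> \<exists>p q. z = of_rat p + of_rat q * e"
proof -
  have sub: "subfield_of K" and dim: "rat_vs.dim K = 2"
    using assms by (auto simp: quadratic_field_def)
  obtain B where B: "B \<subseteq> K" "rat_vs.independent B" "K \<subseteq> rat_vs.span B" "card B = 2"
    using rat_vs.basis_exists[of K] dim by metis
  have fin: "finite B" using B(4) by (metis card.infinite zero_neq_numeral)
  have "\<exists>e\<in>B. e \<notin> \<rat>"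
  proof (rule ccontr)
    assume "\<not> ?thesis"
    then have BQ: "B \<subseteq> \<rat>" by auto
    obtain x y where xy: "B = {x, y}" "x \<noteq> y" using B(4) by (auto simp: card_2_iff)
    have "y \<noteq> 0" using B(2) rat_vs.dependent_zero[of B] xy by auto
    have "x / y \<in> \<rat>" using BQ xy by auto
    then obtain q where "x / y = of_rat q" by (auto elim: Rats_cases)
    then have "x = of_rat q * y" using \<open>y \<noteq> 0\<close> by (simp add: field_simps)
    then have "x \<in> rat_vs.span {y}" by (auto simp: rat_vs.span_singleton)
    then show False using B(2) xy by (simp add: rat_vs.independent_insert)
  qed
  then obtain e where e: "e \<in> K" "e \<notin> \<rat>" using B(1) by auto
  have one: "1 \<in> K" using sub by (simp add: subfield_of_def)
  have in_span: "z \<in> rat_vs.span {e, 1} \<longleftrightarrow> (\<exists>q p. z - of_rat q * e = of_rat p)" for z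
    by (auto simp: rat_vs.span_breakdown_eq rat_vs.span_singleton)
  have ind: "rat_vs.independent {e, 1}"
    using e(2) by (auto simp: rat_vs.independent_insert rat_vs.span_singleton)
  show thesis
  proof (rule that[OF e])
    fix z assume z: "z \<in> K"
    have "z \<in> rat_vs.span {e, 1}"
    proof (rule ccontr)
      assume notin: "z \<notin> rat_vs.span {e, 1}"
      then have "z \<notin> {e, 1}" using rat_vs.span_superset by blast
      then have "rat_vs.independent {z, e, 1}" using notin ind by (simp add: rat_vs.independent_insert)
      moreover have "{z, e, 1} \<subseteq> rat_vs.span B" using z e one B(3) by auto
      ultimately have "card {z, e, 1} \<le> 2"
        using rat_vs.independent_span_bound[OF fin] B(4) by metis
      moreover have "card {z, e, 1} = 3"
        using \<open>z \<notin> {e, 1}\<close> e(2) by (auto simp: card_insert_if)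
      ultimately show False by simp
    qed
    then obtain p q where "z - of_rat q * e = of_rat p" by (auto simp: in_span)
    then have "z = of_rat p + of_rat q * e" by (simp add: algebra_simps)
    then show "\<exists>p q. z = of_rat p + of_rat q * e" by blast
  qed
qed

text \<open>Completing the square turns the generator into a square root \<open>t\<close> of a
  rational \<open>a / b\<close>. Then \<open>b * t\<close> is a square root of the integer
  \<open>a * b\<close>, whose square part is divided out.\<close>

lemma quadratic_field_obtains:
  fixes K :: "'a::field_char_0 set"
  assumes "quadratic_field K"
  obtains s D where "quadratic s D" "K = quadratic.K s"
proof -
  obtain e where e: "e \<in> K" "e \<notin> \<rat>" and span: "\<And>z. z \<in> K \<Longrightarrow> \<exists>p q. z = of_rat p + of_rat q * e"
    using assms by (rule quadratic_field_span) blast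
  have sub: "subfield_of K" using assms by (simp add: quadratic_field_def)
  have "e * e \<in> K" using e(1) sub by (simp add: subfield_of_def)
  then obtain p q where pq: "e * e = of_rat p + of_rat q * e" using span by blast
  define t where "t = e - of_rat (q / 2)"
  have et: "e = t + of_rat (q / 2)" by (simp add: t_def)
  have t: "t \<notin> \<rat>"
  proof
    assume "t \<in> \<rat>"
    then have "e \<in> \<rat>" unfolding et by (intro Rats_add) auto
    with e(2) show False by simp
  qed
  have q2: "of_rat q = (2 * of_rat (q / 2) :: 'a)" by (simp add: of_rat_divide)
  have "t\<^sup>2 = e * e - of_rat q * e + (of_rat (q / 2))\<^sup>2"
    unfolding t_def q2 by (simp add: power2_eq_square algebra_simps)
  then have tsq: "t\<^sup>2 = of_rat (p + (q / 2)\<^sup>2)"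
    unfolding pq by (simp add: of_rat_add of_rat_power)
  obtain a b :: int where ab: "b > 0" "p + (q / 2)\<^sup>2 = of_int a / of_int b"
    by (metis quotient_of_denom_pos' quotient_of_div surj_pair snd_conv)
  define N where "N = a * b"
  have bt: "(of_int b * t)\<^sup>2 = of_int N"
  proof -
    have "(of_int b * t)\<^sup>2 = (of_int b)\<^sup>2 * (of_int a / of_int b)"
      unfolding power_mult_distrib tsq ab(2) by (simp add: of_rat_divide)
    also have "\<dots> = of_int N" using ab(1) by (simp add: N_def power2_eq_square)
    finally show ?thesis .
  qed
  have "N \<noteq> 0"
  proof
    assume "N = 0"
    then have "t = 0" using bt ab(1) by simp
    with t show False by simp
  qed
  define k where "k = square_part N"
  define D where "D = squarefree_part N"
  have k0: "k \<noteq> 0" using \<open>N \<noteq> 0\<close> by (simp add: k_def)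
  have N: "N = D * k\<^sup>2" unfolding D_def k_def by (rule squarefree_decompose)
  define s where "s = of_int b * t / of_int k"
  have s2: "s\<^sup>2 = of_int D"
    unfolding s_def power_divide bt N using k0 by simp
  have ts: "t = of_rat (of_int k / of_int b) * s"
  proof -
    have "of_rat (of_int k / of_int b) * s = of_int k / of_int b * (of_int b * t / of_int k)"
      by (simp only: s_def of_rat_divide of_rat_of_int_eq)
    also have "\<dots> = t" using k0 ab(1) by simp
    finally show ?thesis by simp
  qed
  have s: "s \<notin> \<rat>"
  proof
    assume "s \<in> \<rat>"
    then have "t \<in> \<rat>" unfolding ts by (intro Rats_mult) auto
    with t show False by simp
  qed
  have "D \<noteq> 1"
  proof
    assume "D = 1"
    then have "s = 1 \<or> s = - 1" using s2 by (simp add: power2_eq_1_iff)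
    with s show False by auto
  qed
  then interpret Q: quadratic s D
    by unfold_locales (use s2 in \<open>auto simp: D_def\<close>)
  have "s \<in> Q.K" using Q.s_eq_el Q.el_in_K by metis
  then have "t \<in> Q.K" unfolding ts by (intro Q.K_mult Q.K_of_rat)
  then have eK: "e \<in> Q.K" unfolding et by (intro Q.K_add Q.K_of_rat)
  have "K \<subseteq> Q.K"
  proof
    fix z assume "z \<in> K"
    then obtain p q where "z = of_rat p + of_rat q * e" using span by blast
    then show "z \<in> Q.K" using eK by (simp add: Q.K_add Q.K_mult)
  qed
  moreover have "Q.K \<subseteq> K"
  proof
    fix x assume "x \<in> Q.K"
    then obtain p' q' where x: "x = of_rat p' + of_rat q' * s" by (auto simp: Q.K_def Q.el_def)
    have "s = of_rat (of_int b / of_int k) * (e + of_rat (- (q / 2)))"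
      by (simp add: s_def t_def of_rat_divide of_rat_minus)
    then have "x = of_rat p' + of_rat q' * (of_rat (of_int b / of_int k) * (e + of_rat (- (q / 2))))"
      using x by simp
    then show "x \<in> K"
      using sub e(1) by (simp only: subfield_of_def subfield_of_of_rat[OF sub])
  qed
  ultimately show thesis using that[OF Q.quadratic_axioms] by blast
qed

text \<open>For \<open>s' = p + q * s\<close> with \<open>q\<close> nonzero, the square is rational
  only if \<open>p = 0\<close>. Then \<open>D' = q^2 * D\<close>, and squarefreeness on both sides
  forces \<open>q^2 = 1\<close>. Thus the field determines the integer given to the
  algorithm.\<close>

lemma (in quadratic) discriminant_unique:
  assumes "quadratic s' D'" "quadratic.K s' = K"
  shows "D' = D"
proof -
  interpret Q: quadratic s' D' by fact
  have "s' \<in> K" using assms(2) Q.s_eq_el Q.el_in_K by metis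
  then obtain p q where pq: "s' = el p q" by (rule KE)
  have "el (of_int D') 0 = s' * s'" unfolding Q.s_mult_s by (simp add: el_def)
  also have "\<dots> = el (p * p + of_int D * q * q) (p * q + q * p)" unfolding pq by simp
  finally have eq: "of_int D' = p * p + of_int D * q * q" "p * q + q * p = 0" by simp_all
  have "q \<noteq> 0" using Q.s_notin_Rats pq by auto
  with eq(2) have "p = 0" by auto
  obtain a b where q: "q = of_int a / of_int b" "b > 0" "coprime a b"
    by (cases q) (auto simp: Fract_of_int_quotient)
  have "(of_int (a\<^sup>2 * D) :: rat) = of_int (D' * b\<^sup>2)"
    using eq(1) q(2) unfolding \<open>p = 0\<close> q(1) by (simp add: field_simps power2_eq_square)
  then have eq': "a\<^sup>2 * D = D' * b\<^sup>2" by (simp only: of_int_eq_iff)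
  then have "b\<^sup>2 dvd D" by (rule int_square_dvd_imp_dvd[OF q(3)])
  then have "b dvd 1" by (rule squarefreeD[OF sqfree])
  then have "b\<^sup>2 = 1" by (metis power2_abs one_power2 zdvd1_eq)
  with eq' have eq'': "a\<^sup>2 * D = D'" by simp
  then have "a\<^sup>2 dvd D'" by auto
  then have "a dvd 1" by (rule squarefreeD[OF Q.sqfree])
  then have "a\<^sup>2 = 1" by (metis power2_abs one_power2 zdvd1_eq)
  with eq'' show "D' = D" by simp
qed


section \<open>Evaluation of polynomials\<close>

definition monom_eval :: "'a::comm_ring_1 list \<Rightarrow> (nat \<Rightarrow>\<^sub>0 nat) \<Rightarrow> 'a" where
  "monom_eval xs m = (\<Prod>i\<in>Poly_Mapping.keys m. xs ! i ^ Poly_Mapping.lookup m i)"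

text \<open>Additional indices have exponent 0. A common index set allows two monomials to be
  multiplied factor by factor.\<close>

lemma monom_eval_superset:
  "finite S \<Longrightarrow> Poly_Mapping.keys m \<subseteq> S \<Longrightarrow>
    monom_eval xs m = (\<Prod>i\<in>S. xs ! i ^ Poly_Mapping.lookup m i)"
  unfolding monom_eval_def by (rule prod.mono_neutral_left) (auto simp: in_keys_iff)

lemma monom_eval_add: "monom_eval xs (m + m') = monom_eval xs m * monom_eval xs m'"
proof -
  define S where "S = Poly_Mapping.keys m \<union> Poly_Mapping.keys m'"
  have S: "finite S" "Poly_Mapping.keys m \<subseteq> S" "Poly_Mapping.keys m' \<subseteq> S" "Poly_Mapping.keys (m + m') \<subseteq> S"
    using keys_add[of m m'] by (auto simp: S_def)
  show ?thesis
    by (simp add: monom_eval_superset[OF S(1)] S lookup_add power_add prod.distrib)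
qed

lemma mpoly_eval_superset:
  "finite S \<Longrightarrow> Poly_Mapping.keys p \<subseteq> S \<Longrightarrow>
    mpoly_eval p xs = (\<Sum>m\<in>S. of_int (Poly_Mapping.lookup p m) * monom_eval xs m)"
  unfolding mpoly_eval_def monom_eval_def by (rule sum.mono_neutral_left) (auto simp: in_keys_iff)

lemma mpoly_eval_add: "mpoly_eval (p + q) xs = mpoly_eval p xs + mpoly_eval q xs"
proof -
  define S where "S = Poly_Mapping.keys p \<union> Poly_Mapping.keys q"
  have S: "finite S" "Poly_Mapping.keys p \<subseteq> S" "Poly_Mapping.keys q \<subseteq> S" "Poly_Mapping.keys (p + q) \<subseteq> S"
    using keys_add[of p q] by (auto simp: S_def)
  show ?thesis
    by (simp add: mpoly_eval_superset[OF S(1)] S lookup_add distrib_right sum.distrib)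
qed

lemma mpoly_eval_single: "mpoly_eval (Poly_Mapping.single m c) xs = of_int c * monom_eval xs m"
  by (subst mpoly_eval_superset[of "{m}"]) auto

lemma mpoly_eval_diff: "mpoly_eval (p - q) xs = mpoly_eval p xs - mpoly_eval q xs"
  using mpoly_eval_add[of "p - q" q xs] by simp

lemma mpoly_eval_0: "mpoly_eval 0 xs = 0"
  by (simp add: mpoly_eval_def)

text \<open>Polynomials with integer coefficients form the free abelian group on the monomials, so
  \<open>frag_induction\<close> reduces the two factors, one after the other, to single
  monomials.\<close>

lemma mpoly_eval_mult: "mpoly_eval (p * q) xs = mpoly_eval p xs * mpoly_eval q xs"
proof -
  have "mpoly_eval (Poly_Mapping.single m 1 * q) xs = monom_eval xs m * mpoly_eval q xs" for m
    using subset_UNIV[of "Poly_Mapping.keys q"]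
  proof (induction q rule: frag_induction)
    case zero
    then show ?case by (simp add: mpoly_eval_0)
  next
    case (one m')
    then show ?case by (simp add: mult_single mpoly_eval_single monom_eval_add)
  next
    case (diff a b)
    then show ?case by (simp add: right_diff_distrib mpoly_eval_diff)
  qed
  note single = this
  show ?thesis
    using subset_UNIV[of "Poly_Mapping.keys p"]
  proof (induction p rule: frag_induction)
    case zero
    then show ?case by (simp add: mpoly_eval_0)
  next
    case (one m)
    then show ?case by (simp add: single mpoly_eval_single)
  next
    case (diff a b)
    then show ?case by (simp add: left_diff_distrib mpoly_eval_diff)
  qed
qed

lemma ring_morphism_mpoly_eval: "ring_morphism (\<lambda>p. mpoly_eval p xs)"
proof
  show "mpoly_eval 1 xs = 1"
    using mpoly_eval_single[of 0 1 xs] by (simp add: monom_eval_def)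
qed (rule mpoly_eval_add mpoly_eval_mult)+

lemma mpoly_eval_mvar: "mpoly_eval (mvar i) xs = xs ! i"
  by (simp add: mvar_def mpoly_eval_single monom_eval_def)

lemma mpoly_eval_append:
  assumes "p \<in> int_mpolys (length xs)"
  shows "mpoly_eval p (xs @ ys) = mpoly_eval p xs"
proof -
  have "i < length xs" if "m \<in> Poly_Mapping.keys p" "i \<in> Poly_Mapping.keys m" for i m
    using assms that by (auto simp: int_mpolys_def mpoly_vars_def)
  then show ?thesis
    unfolding mpoly_eval_def by (intro sum.cong prod.cong refl arg_cong2[of _ _ _ _ "(*)"])
      (simp add: nth_append)
qed

text \<open>Applied with the ring of integers and with the rational integers as
  \<open>S\<close>.\<close>

lemma mpoly_eval_closed:
  assumes p: "p \<in> int_mpolys (length xs)" and xs: "set xs \<subseteq> S"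
    and S: "\<And>k. of_int k \<in> S" "\<And>x y. x \<in> S \<Longrightarrow> y \<in> S \<Longrightarrow> x + y \<in> S" "\<And>x y. x \<in> S \<Longrightarrow> y \<in> S \<Longrightarrow> x * y \<in> S"
  shows "mpoly_eval p xs \<in> S"
proof -
  have S01: "0 \<in> S" "1 \<in> S" using S(1)[of 0] S(1)[of 1] by auto
  have power: "x ^ k \<in> S" if "x \<in> S" for x k
    using that by (induction k) (auto simp: S S01)
  have prod: "prod f A \<in> S" if "\<And>i. i \<in> A \<Longrightarrow> f i \<in> S" for f :: "nat \<Rightarrow> 'a" and A
    using that by (induction A rule: infinite_finite_induct) (auto simp: S S01)
  have sum: "sum f A \<in> S" if "\<And>i. i \<in> A \<Longrightarrow> f i \<in> S" for f :: "(nat \<Rightarrow>\<^sub>0 nat) \<Rightarrow> 'a" and A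
    using that by (induction A rule: infinite_finite_induct) (auto simp: S S01)
  show ?thesis
    unfolding mpoly_eval_def
  proof (intro sum S(1,3) prod power)
    fix m i assume "m \<in> Poly_Mapping.keys p" "i \<in> Poly_Mapping.keys m"
    then have "i < length xs" using p by (auto simp: int_mpolys_def mpoly_vars_def)
    then show "xs ! i \<in> S" using xs by auto
  qed
qed

section \<open>Closure properties of polynomials in a given number of variables\<close>

lemma int_mpolys_add: "p \<in> int_mpolys N \<Longrightarrow> q \<in> int_mpolys N \<Longrightarrow> p + q \<in> int_mpolys N"
  using keys_add[of p q] by (auto simp: int_mpolys_def mpoly_vars_def) blast

lemma int_mpolys_mult: "p \<in> int_mpolys N \<Longrightarrow> q \<in> int_mpolys N \<Longrightarrow> p * q \<in> int_mpolys N"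
proof -
  assume pq: "p \<in> int_mpolys N" "q \<in> int_mpolys N"
  have "i < N" if m: "m \<in> Poly_Mapping.keys (p * q)" and i: "i \<in> Poly_Mapping.keys m" for m i
  proof -
    obtain a b where "m = a + b" "a \<in> Poly_Mapping.keys p" "b \<in> Poly_Mapping.keys q"
      using m keys_mult[of p q] by auto
    then show "i < N"
      using i keys_add[of a b] pq unfolding int_mpolys_def mpoly_vars_def by blast
  qed
  then show ?thesis by (auto simp: int_mpolys_def mpoly_vars_def)
qed

lemma int_mpolys_of_int: "of_int k \<in> int_mpolys N"
  by (simp add: int_mpolys_def mpoly_vars_def flip: single_of_int)

lemma int_mpolys_mvar: "i < N \<Longrightarrow> mvar i \<in> int_mpolys N"
  by (simp add: int_mpolys_def mpoly_vars_def mvar_def)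

lemma int_mpolys_numeral: "numeral k \<in> int_mpolys N" "1 \<in> int_mpolys N"
  using int_mpolys_of_int[of "numeral k" N] int_mpolys_of_int[of 1 N] by auto

lemma int_mpolys_diff: "p \<in> int_mpolys N \<Longrightarrow> q \<in> int_mpolys N \<Longrightarrow> p - q \<in> int_mpolys N"
  using int_mpolys_add[of p N "of_int (- 1) * q"] int_mpolys_mult[OF int_mpolys_of_int[of "- 1" N], of q]
  by simp

lemma int_mpolys_power: "p \<in> int_mpolys N \<Longrightarrow> p ^ k \<in> int_mpolys N"
  by (induction k) (auto simp: int_mpolys_mult int_mpolys_numeral)

lemma int_mpolys_sum: "(\<And>i. i \<in> A \<Longrightarrow> f i \<in> int_mpolys N) \<Longrightarrow> sum f A \<in> int_mpolys N"
  using int_mpolys_of_int[of 0 N]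
  by (induction A rule: infinite_finite_induct) (auto simp: int_mpolys_add)

lemma int_mpolys_prod: "(\<And>i. i \<in> A \<Longrightarrow> f i \<in> int_mpolys N) \<Longrightarrow> prod f A \<in> int_mpolys N"
  by (induction A rule: infinite_finite_induct) (auto simp: int_mpolys_mult int_mpolys_numeral)

lemmas int_mpolys_intros = int_mpolys_add int_mpolys_mult int_mpolys_of_int int_mpolys_mvar
  int_mpolys_numeral int_mpolys_diff int_mpolys_power int_mpolys_sum int_mpolys_prod

lemma chain_in_int_mpolys: "u \<in> int_mpolys N \<Longrightarrow> chain d u i \<in> int_mpolys N"
  by (induction i) (auto intro!: int_mpolys_intros)

lemma defining_poly_in_int_mpolys:
  assumes "\<And>i. i < n \<Longrightarrow> a i \<in> int_mpolys N" "R \<in> int_mpolys N" "w \<in> int_mpolys N"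
    "r \<in> int_mpolys N" "j \<in> int_mpolys N"
  shows "defining_poly d n a R w r j \<in> int_mpolys N"
  unfolding defining_poly_def Let_def combine_def digits_def weight_def
  by (intro int_mpolys_intros chain_in_int_mpolys assms) auto

lemma int_mpolys_mono: "n \<le> N \<Longrightarrow> R \<in> int_mpolys n \<Longrightarrow> R \<in> int_mpolys N"
  by (auto simp: int_mpolys_def)

section \<open>Computing the polynomial\<close>

text \<open>Nonnegative integers \<open>k\<close> have the code \<open>2 * k\<close>, and \<open>- 1\<close> has the code \<open>1\<close>.\<close>

definition disc_code :: "nat \<Rightarrow> nat" where
  "disc_code b = const_code (b * (1 - b mod 2) + 6 * (b mod 2))"

definition square_code :: "nat \<Rightarrow> nat" where
  "square_code p = mult_code p p"

definition diff_code :: "nat \<Rightarrow> nat \<Rightarrow> nat" where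
  "diff_code p q = add_code p (mult_code (const_code 1) q)"

text \<open>Constants appear through their codes, here and below: 2, 4, 6 and 8 stand for 1, 2, 3
  and 4. The argument \<open>d\<close> is the code of a constant polynomial.\<close>

definition chain_code :: "nat \<Rightarrow> nat \<Rightarrow> nat \<Rightarrow> nat" where
  "chain_code d u i = rec_nat u (\<lambda>_ g. add_code (mult_code (const_code 6) g)
     (mult_code (const_code 8) (mult_code d (mult_code g (square_code g))))) i"

definition digits_code :: "nat \<Rightarrow> nat \<Rightarrow> nat \<Rightarrow> nat" where
  "digits_code d u n = rec_nat (const_code 2) (\<lambda>i q. add_code q
     (mult_code (const_code 4) (mult_code (var_code i) (chain_code d u i)))) n"

definition weight_code :: "nat \<Rightarrow> nat \<Rightarrow> nat" where
  "weight_code n c = mult_code (const_code 8) (mult_code c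
     (rec_nat (const_code 2) (\<lambda>i q. mult_code q (add_code
        (mult_code (const_code 4) (square_code (var_code i))) (const_code 2))) n))"

definition combine_code :: "nat \<Rightarrow> nat \<Rightarrow> nat \<Rightarrow> nat \<Rightarrow> nat \<Rightarrow> nat" where
  "combine_code d P t A1 A2 =
     add_code
       (diff_code (square_code (square_code t))
          (mult_code (const_code 4) (mult_code (square_code t)
             (mult_code (square_code P) (add_code A1 (mult_code (square_code d) A2))))))
       (mult_code (square_code (square_code P))
          (square_code (diff_code A1 (mult_code (square_code d) A2))))"

text \<open>The variables \<open>n\<close>, \<open>n + 1\<close> and \<open>n + 2\<close>, which
  follow the given ones, play the roles of \<open>w\<close>, \<open>r\<close> and \<open>j\<close>;
  \<open>b\<close> is the code of \<open>D\<close>.\<close>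

definition defining_poly_code :: "nat \<Rightarrow> nat \<Rightarrow> nat \<Rightarrow> nat" where
  "defining_poly_code b n c =
     (let d = disc_code b; r = var_code (n + 1);
        u = mult_code (weight_code n c) (var_code n); P = chain_code d u n;
        v = add_code (digits_code d u n) (mult_code P r)
      in combine_code d P
        (diff_code (mult_code P (var_code (n + 2)))
          (mult_code (diff_code (mult_code (const_code 4) r) (const_code 2))
             (diff_code (mult_code (const_code 6) r) (const_code 2))))
        (add_code (const_code 2) (mult_code d (square_code u)))
        (add_code (const_code 2) (mult_code d (square_code (mult_code P v)))))"

lemma int_decode_numerals:
  "int_decode 1 = - 1" "int_decode (Suc 0) = - 1" "int_decode 2 = 1" "int_decode 4 = 2"
  "int_decode 6 = 3" "int_decode 8 = 4"
  by (simp_all add: int_decode_eq)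

lemma mpoly_of_code_square [simp]: "mpoly_of_code (square_code p) = mpoly_of_code p ^ 2"
  by (simp add: square_code_def power2_eq_square)

lemma mpoly_of_code_diff [simp]: "mpoly_of_code (diff_code p q) = mpoly_of_code p - mpoly_of_code q"
  by (simp add: diff_code_def int_decode_numerals)

text \<open>Even codes belong to nonnegative integers and are kept; odd codes belong to negative
  ones and are replaced by 6, the code of 3. This is the case distinction of
  \<open>d\<close>.\<close>

lemma mpoly_of_code_disc:
  assumes "quadratic (s :: 'a::field_char_0) D"
  shows "mpoly_of_code (disc_code (int_encode D)) = of_int (quadratic.d D)"
proof (cases "D > 0")
  case True
  then have "int_encode D = 2 * nat D"
    by (simp add: int_encode_def sum_encode_def)
  with True show ?thesis
    by (simp add: disc_code_def quadratic.d_def[OF assms] int_decode_eq)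
next
  case False
  then have "int_encode D = Suc (2 * nat (- D - 1))"
    using quadratic.D_neq_0[OF assms] by (simp add: int_encode_def sum_encode_def)
  with False show ?thesis
    by (simp add: disc_code_def quadratic.d_def[OF assms] int_decode_numerals)
qed

lemma mpoly_of_code_chain:
  assumes "mpoly_of_code d' = of_int d"
  shows "mpoly_of_code (chain_code d' u i) = chain d (mpoly_of_code u) i"
  by (induction i) (simp_all add: chain_code_def assms int_decode_numerals power2_eq_square power3_eq_cube)

lemma mpoly_of_code_digits:
  assumes "mpoly_of_code d' = of_int d"
  shows "mpoly_of_code (digits_code d' u n) = digits d (mpoly_of_code u) mvar n"
  unfolding digits_def
  by (induction n) (simp_all add: digits_code_def mpoly_of_code_chain[OF assms] int_decode_numerals add_ac)

lemma mpoly_of_code_weight: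
  "mpoly_of_code (weight_code n c) = weight mvar n (mpoly_of_code c)"
proof -
  have "mpoly_of_code (rec_nat (const_code 2) (\<lambda>i q. mult_code q (add_code
        (mult_code (const_code 4) (square_code (var_code i))) (const_code 2))) n) =
      (\<Prod>i<n. 2 * mvar i ^ 2 + 1)"
    by (induction n) (simp_all add: int_decode_numerals)
  then show ?thesis by (simp add: weight_code_def weight_def int_decode_numerals)
qed

lemma mpoly_of_code_defining_poly:
  assumes "quadratic (s :: 'a::field_char_0) D"
  shows "mpoly_of_code (defining_poly_code (int_encode D) n c) =
    defining_poly (quadratic.d D) n mvar (mpoly_of_code c) (mvar n) (mvar (n + 1)) (mvar (n + 2))"
proof -
  \<comment> \<open>\<open>combine_code\<close> forms fourth powers by squaring twice.\<close>
  have power4: "(x ^ 2) ^ 2 = x ^ 4" for x :: int_mpoly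
    by (simp flip: power_mult)
  note disc = mpoly_of_code_disc[OF assms]
  show ?thesis
    by (simp add: defining_poly_code_def defining_poly_def Let_def combine_code_def combine_def disc
      mpoly_of_code_weight mpoly_of_code_chain[OF disc] mpoly_of_code_digits[OF disc]
      int_decode_numerals power4)
qed

section \<open>Recursiveness of the construction\<close>

lemma total_recursive_square_code [rec_intros]:
  "total_recursive k f \<Longrightarrow> total_recursive k (\<lambda>xs. square_code (f xs))"
  unfolding square_code_def by (intro rec_intros)

lemma total_recursive_diff_code [rec_intros]:
  "total_recursive k f \<Longrightarrow> total_recursive k g \<Longrightarrow> total_recursive k (\<lambda>xs. diff_code (f xs) (g xs))"
  unfolding diff_code_def by (intro rec_intros)

lemma total_recursive_disc_code [rec_intros]:
  "total_recursive k f \<Longrightarrow> total_recursive k (\<lambda>xs. disc_code (f xs))"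
  unfolding disc_code_def by (intro rec_intros)

lemma total_recursive_chain_code [rec_intros]:
  assumes "total_recursive k f" "total_recursive k g" "total_recursive k l"
  shows "total_recursive k (\<lambda>xs. chain_code (f xs) (g xs) (l xs))"
proof -
  have "total_recursive 3 (\<lambda>xs. chain_code (xs ! 0) (xs ! 1) (xs ! 2))"
    unfolding chain_code_def by (intro rec_intros) auto
  from total_recursive_comp3[OF this assms] show ?thesis .
qed

lemma total_recursive_digits_code [rec_intros]:
  assumes "total_recursive k f" "total_recursive k g" "total_recursive k l"
  shows "total_recursive k (\<lambda>xs. digits_code (f xs) (g xs) (l xs))"
proof -
  have "total_recursive 3 (\<lambda>xs. digits_code (xs ! 0) (xs ! 1) (xs ! 2))"
    unfolding digits_code_def by (intro rec_intros) auto
  from total_recursive_comp3[OF this assms] show ?thesis .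
qed

lemma total_recursive_weight_code [rec_intros]:
  assumes "total_recursive k f" "total_recursive k g"
  shows "total_recursive k (\<lambda>xs. weight_code (f xs) (g xs))"
proof -
  have "total_recursive 2 (\<lambda>xs. weight_code (xs ! 0) (xs ! 1))"
    unfolding weight_code_def by (intro rec_intros) auto
  from total_recursive_comp2[OF this assms] show ?thesis .
qed

lemma total_recursive_combine_code [rec_intros]:
  assumes "total_recursive k f1" "total_recursive k f2" "total_recursive k f3"
    "total_recursive k f4" "total_recursive k f5"
  shows "total_recursive k (\<lambda>xs. combine_code (f1 xs) (f2 xs) (f3 xs) (f4 xs) (f5 xs))"
  unfolding combine_code_def by (intro rec_intros assms)

lemma total_recursive_defining_poly_code:
  "total_recursive 3 (\<lambda>xs. defining_poly_code (xs ! 0) (xs ! 1) (xs ! 2))"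
  unfolding defining_poly_code_def Let_def by (intro rec_intros) auto


text \<open>Needed because \<Phi> receives only the set \<open>K\<close>; by
  \<open>discriminant_unique\<close> the choice is unambiguous for quadratic fields.\<close>

definition field_disc :: "'a::field_char_0 set \<Rightarrow> int" where
  "field_disc K = (SOME D. \<exists>s. quadratic s D \<and> quadratic.K s = K)"

lemma field_disc_eq:
  assumes "quadratic s D"
  shows "field_disc (quadratic.K s) = D"
proof -
  have "\<exists>s'. quadratic s' (field_disc (quadratic.K s)) \<and> quadratic.K s' = quadratic.K s"
    unfolding field_disc_def by (rule someI_ex) (use assms in blast)
  then show ?thesis using quadratic.discriminant_unique[OF assms] by blast
qed

theorem theorem1p2:
  shows "\<exists>\<Phi> :: 'a::field_char_0 set \<Rightarrow> nat \<Rightarrow> int_mpoly \<Rightarrow> int_mpoly.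
    (\<forall>K n R. quadratic_field K \<and> R \<in> int_mpolys n \<longrightarrow>
       \<Phi> K n R \<in> int_mpolys (n + 3) \<and>
       (\<forall>a. length a = n \<and> set a \<subseteq> ring_of_integers K \<longrightarrow>
          ((\<exists>u\<in>ring_of_integers K. \<exists>v\<in>ring_of_integers K. \<exists>j\<in>ring_of_integers K.
              mpoly_eval (\<Phi> K n R) (a @ [u, v, j]) = 0)
           \<longleftrightarrow> set a \<subseteq> \<int> \<and> mpoly_eval R a \<noteq> 0))) \<and>
    (\<exists>F. total_recursive 3 F \<and>
       (\<forall>K D n c. quadratic_field K \<and> squarefree D \<and> D \<noteq> 0 \<and> D \<noteq> 1 \<and>
          is_rat_adjoin_sqrt K D \<and> mpoly_of_code c \<in> int_mpolys n \<longrightarrow>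
          mpoly_of_code (F [int_encode D, n, c]) = \<Phi> K n (mpoly_of_code c)))"
proof -
  define \<Phi> :: "'a set \<Rightarrow> nat \<Rightarrow> int_mpoly \<Rightarrow> int_mpoly" where
    "\<Phi> = (\<lambda>K n R. defining_poly (quadratic.d (field_disc K)) n mvar R (mvar n) (mvar (n + 1)) (mvar (n + 2)))"
  have main: "\<Phi> K n R \<in> int_mpolys (n + 3) \<and>
      (\<forall>a. length a = n \<and> set a \<subseteq> ring_of_integers K \<longrightarrow>
          ((\<exists>u\<in>ring_of_integers K. \<exists>v\<in>ring_of_integers K. \<exists>j\<in>ring_of_integers K.
              mpoly_eval (\<Phi> K n R) (a @ [u, v, j]) = 0)
           \<longleftrightarrow> set a \<subseteq> \<int> \<and> mpoly_eval R a \<noteq> 0))"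
    if K: "quadratic_field K" and R: "R \<in> int_mpolys n" for K n R
  proof (intro conjI allI impI)
    show "\<Phi> K n R \<in> int_mpolys (n + 3)"
      unfolding \<Phi>_def
      by (intro defining_poly_in_int_mpolys int_mpolys_mvar int_mpolys_mono[OF _ R]) auto
    fix a assume a: "length a = n \<and> set a \<subseteq> ring_of_integers K"
    obtain s D where sD: "quadratic s D" and K_eq: "K = quadratic.K s"
      using quadratic_field_obtains[OF K] .
    interpret quadratic s D by (rule sD)
    \<comment> \<open>Evaluation is a ring homomorphism, so it moves inside the construction;
      \<open>R\<close> does not see the three appended unknowns.\<close>
    have eval: "mpoly_eval (\<Phi> K n R) (a @ [u, v, j]) =
        defining_poly d n (\<lambda>i. a ! i) (mpoly_eval R a) u v j" for u v j
    proof -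
      have "mpoly_eval (\<Phi> K n R) (a @ [u, v, j]) = defining_poly d n (\<lambda>i. (a @ [u, v, j]) ! i)
          (mpoly_eval R (a @ [u, v, j])) ((a @ [u, v, j]) ! n) ((a @ [u, v, j]) ! (n + 1)) ((a @ [u, v, j]) ! (n + 2))"
        unfolding \<Phi>_def K_eq field_disc_eq[OF sD]
          ring_morphism.defining_poly[OF ring_morphism_mpoly_eval] mpoly_eval_mvar ..
      also have "\<dots> = defining_poly d n (\<lambda>i. (a @ [u, v, j]) ! i) (mpoly_eval R a) u v j"
        using a R by (simp add: nth_append mpoly_eval_append)
      also have "\<dots> = defining_poly d n (\<lambda>i. a ! i) (mpoly_eval R a) u v j"
        using a by (intro defining_poly_cong) (simp add: nth_append)
      finally show ?thesis .
    qed
    have R': "R \<in> int_mpolys (length a)" using R a by simp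
    have "a ! i \<in> OK" if "i < n" for i using a that by (auto simp: K_eq)
    moreover have "mpoly_eval R a \<in> OK"
      using a by (intro mpoly_eval_closed[OF R'] OK_of_int OK_add OK_mult) (auto simp: K_eq)
    moreover have ints: "(\<forall>i<n. a ! i \<in> \<int>) \<longleftrightarrow> set a \<subseteq> \<int>"
      using a by (auto simp: subset_iff in_set_conv_nth)
    moreover have "mpoly_eval R a \<in> \<int>" if "\<forall>i<n. a ! i \<in> \<int>"
      using that ints by (intro mpoly_eval_closed[OF R']) auto
    ultimately show "(\<exists>u\<in>ring_of_integers K. \<exists>v\<in>ring_of_integers K. \<exists>j\<in>ring_of_integers K.
        mpoly_eval (\<Phi> K n R) (a @ [u, v, j]) = 0) \<longleftrightarrow> set a \<subseteq> \<int> \<and> mpoly_eval R a \<noteq> 0"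
      unfolding eval unfolding K_eq using defining_poly_zero_iff[of n "\<lambda>i. a ! i" "mpoly_eval R a"] by blast
  qed
  have effective: "mpoly_of_code (defining_poly_code (int_encode D) n c) = \<Phi> K n (mpoly_of_code c)"
    if D: "squarefree D" "D \<noteq> 1" "is_rat_adjoin_sqrt K D" for K D n c
  proof -
    obtain s where s: "s\<^sup>2 = of_int D" "K = rat_adjoin s"
      using D(3) by (auto simp: is_rat_adjoin_sqrt_def)
    then have sD: "quadratic s D" using D by unfold_locales
    \<comment> \<open>Whichever square root of \<open>D\<close> generates \<open>K\<close>,
      \<open>field_disc_eq\<close> identifies \<open>D\<close> with the integer chosen in
      \<Phi>.\<close>
    have "K = quadratic.K s" using s(2) quadratic.rat_adjoin_eq_K[OF sD] by simp
    then show ?thesis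
      using mpoly_of_code_defining_poly[OF sD] by (simp add: \<Phi>_def field_disc_eq[OF sD])
  qed
  show ?thesis
  proof (intro exI[of _ \<Phi>] conjI)
    define F where "F = (\<lambda>xs. defining_poly_code (xs ! 0) (xs ! 1) (xs ! 2))"
    have "total_recursive 3 F" unfolding F_def by (rule total_recursive_defining_poly_code)
    moreover have "mpoly_of_code (F [int_encode D, n, c]) = \<Phi> K n (mpoly_of_code c)"
      if "squarefree D" "D \<noteq> 1" "is_rat_adjoin_sqrt K D" for K D n c
      using effective[OF that] by (simp add: F_def)
    ultimately show "\<exists>F. total_recursive 3 F \<and>
       (\<forall>K D n c. quadratic_field K \<and> squarefree D \<and> D \<noteq> 0 \<and> D \<noteq> 1 \<and>
          is_rat_adjoin_sqrt K D \<and> mpoly_of_code c \<in> int_mpolys n \<longrightarrow>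
          mpoly_of_code (F [int_encode D, n, c]) = \<Phi> K n (mpoly_of_code c))"
      by (intro exI[of _ F]) blast
  qed (use main in blast)
qed

end
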